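(* Let $q$ be an odd prime power. In $\mathrm{PG}(3,q^2)$, let $\mathcal H$ be a non-degenerate Hermitian surface and $\mathcal Q$ an irreducible quadric such that there is a point $P\in\mathcal H\cap\mathcal Q$ which is a nonsingular point of $\mathcal Q$ and at which $\mathcal H$ and $\mathcal Q$ have the same tangent plane. Suppose $|\mathcal H\cap\mathcal Q|=q^2+1$. Then $\mathcal Q$ is a hyperbolic quadric and $\Omega=\mathcal H\cap\mathcal Q$ is an elliptic quadric contained in a subgeometry $\mathrm{PG}(3,q)$ embedded in $\mathrm{PG}(3,q^2)$.
   Context: A subgeometry $\mathrm{PG}(3,q)$ of $\mathrm{PG}(3,q^2)$ is a Baer subgeometry, i.e. the image under a collineation of the set of points with coordinates in $\mathrm{GF}(q)$. *)

theory Defs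
  imports
    "HOL-Analysis.Analysis"
    "HOL-Library.Poly_Mapping"
    "HOL-Number_Theory.Prime_Powers"
begin

subsection \<open>Projective space\<close>

definition proj_points :: "('a::field ^ 'n) set set" where
  "proj_points = {vec.span {v} | v. v \<noteq> 0}"

definition proj_lines :: "('a::field ^ 'n) set set set" where
  "proj_lines = {{P \<in> proj_points. P \<subseteq> W} | W. vec.subspace W \<and> vec.dim W = 2}"

definition collineation :: "(('a::field ^ 'n) set \<Rightarrow> ('a ^ 'n) set) \<Rightarrow> bool" where
  "collineation g \<longleftrightarrow> bij_betw g proj_points proj_points \<and>
     (\<forall>L. L \<subseteq> proj_points \<longrightarrow> (L \<in> proj_lines \<longleftrightarrow> g ` L \<in> proj_lines))"


subsection \<open>Hermitian varieties\<close>

text \<open>Here the ground field has order \<open>q\<^sup>2\<close>, so that \<open>x \<mapsto> x ^ q\<close> is its involutory automorphism.\<close>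

definition hermitian_matrix :: "nat \<Rightarrow> 'a::field ^ 'n ^ 'n \<Rightarrow> bool" where
  "hermitian_matrix q A \<longleftrightarrow> (\<forall>i j. A $ j $ i = (A $ i $ j) ^ q)"

definition herm_form :: "nat \<Rightarrow> 'a::field ^ 'n ^ 'n \<Rightarrow> 'a ^ 'n \<Rightarrow> 'a ^ 'n \<Rightarrow> 'a" where
  "herm_form q A x y = (\<Sum>i\<in>UNIV. \<Sum>j\<in>UNIV. A $ i $ j * x $ i * (y $ j) ^ q)"

definition hermitian_variety :: "nat \<Rightarrow> 'a::field ^ 'n ^ 'n \<Rightarrow> ('a ^ 'n) set set" where
  "hermitian_variety q A = {X \<in> proj_points. \<forall>x\<in>X. herm_form q A x x = 0}"

definition hermitian_tangent ::
    "nat \<Rightarrow> 'a::field ^ 'n ^ 'n \<Rightarrow> ('a ^ 'n) set \<Rightarrow> ('a ^ 'n) set set" where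
  "hermitian_tangent q A P = {X \<in> proj_points. \<forall>x\<in>X. \<forall>p\<in>P. herm_form q A x p = 0}"


subsection \<open>Quadrics\<close>

text \<open>
  A quadric is given by the coefficients of the homogeneous polynomial
  \<open>\<Sum>i j. B\<^sub>i\<^sub>j X\<^sub>i X\<^sub>j\<close>; the matrix \<open>B\<close> need not be symmetric.
\<close>

definition quad_form :: "'a::field ^ 'n ^ 'n \<Rightarrow> 'a ^ 'n \<Rightarrow> 'a" where
  "quad_form B x = (\<Sum>i\<in>UNIV. \<Sum>j\<in>UNIV. B $ i $ j * x $ i * x $ j)"

text \<open>The same expression as an element of the polynomial ring in the variables \<open>X\<^sub>i\<close>,
  whose monomials are the finitely supported exponent functions.\<close>

definition quad_poly :: "'a::field ^ 'n ^ 'n \<Rightarrow> ('n \<Rightarrow>\<^sub>0 nat) \<Rightarrow>\<^sub>0 'a" where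
  "quad_poly B = (\<Sum>i\<in>UNIV. \<Sum>j\<in>UNIV.
     Poly_Mapping.single (Poly_Mapping.single i 1 + Poly_Mapping.single j 1) (B $ i $ j))"

definition irreducible_quadric :: "'a::field ^ 'n ^ 'n \<Rightarrow> bool" where
  "irreducible_quadric B \<longleftrightarrow> irreducible (quad_poly B)"

definition quadric :: "'a::field ^ 'n ^ 'n \<Rightarrow> ('a ^ 'n) set set" where
  "quadric B = {X \<in> proj_points. \<forall>x\<in>X. quad_form B x = 0}"

text \<open>The vector of partial derivatives of the polynomial at \<open>x\<close>.\<close>

definition quad_gradient :: "'a::field ^ 'n ^ 'n \<Rightarrow> 'a ^ 'n \<Rightarrow> 'a ^ 'n" where
  "quad_gradient B x = (\<chi> j. \<Sum>i\<in>UNIV. (B $ i $ j + B $ j $ i) * x $ i)"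

definition nonsingular_point :: "'a::field ^ 'n ^ 'n \<Rightarrow> ('a ^ 'n) set \<Rightarrow> bool" where
  "nonsingular_point B P \<longleftrightarrow> P \<in> quadric B \<and> (\<exists>p\<in>P. quad_gradient B p \<noteq> 0)"

definition quadric_tangent :: "'a::field ^ 'n ^ 'n \<Rightarrow> ('a ^ 'n) set \<Rightarrow> ('a ^ 'n) set set" where
  "quadric_tangent B P =
     {X \<in> proj_points. \<forall>x\<in>X. \<forall>p\<in>P. (\<Sum>j\<in>UNIV. quad_gradient B p $ j * x $ j) = 0}"

text \<open>Hyperbolic quadrics of three-dimensional space, by their canonical form
  \<open>X\<^sub>1 X\<^sub>2 + X\<^sub>3 X\<^sub>4\<close>. A scalar factor is absorbed by the change of coordinates.\<close>

definition hyperbolic_quadric :: "'a::field ^ 4 ^ 4 \<Rightarrow> bool" where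
  "hyperbolic_quadric B \<longleftrightarrow>
     (\<exists>M :: 'a ^ 4 ^ 4. invertible M \<and>
        (\<forall>x. quad_form B (M *v x) = x $ 1 * x $ 2 + x $ 3 * x $ 4))"


subsection \<open>Baer subgeometries and their elliptic quadrics\<close>

text \<open>The subfield of order \<open>q\<close> of a field of order \<open>q\<^sup>2\<close>.\<close>

definition GF_sub :: "nat \<Rightarrow> 'a::field set" where
  "GF_sub q = {x. x ^ q = x}"

definition canonical_subgeometry :: "nat \<Rightarrow> ('a::field ^ 'n) set set" where
  "canonical_subgeometry q = {vec.span {v} | v. v \<noteq> 0 \<and> (\<forall>i. v $ i \<in> GF_sub q)}"

definition baer_subgeometry :: "nat \<Rightarrow> ('a::field ^ 'n) set set \<Rightarrow> bool" where
  "baer_subgeometry q \<Sigma> \<longleftrightarrow> (\<exists>g. collineation g \<and> \<Sigma> = g ` canonical_subgeometry q)"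

text \<open>Irreducibility over \<open>K\<close> of the binary quadratic form \<open>a X\<^sup>2 + b X Y + c Y\<^sup>2\<close>: it is not
  a product \<open>(l\<^sub>1 X + l\<^sub>2 Y) (m\<^sub>1 X + m\<^sub>2 Y)\<close>.\<close>

definition irreducible_binary :: "'a::field set \<Rightarrow> 'a \<Rightarrow> 'a \<Rightarrow> 'a \<Rightarrow> bool" where
  "irreducible_binary K a b c \<longleftrightarrow>
     \<not> (\<exists>l1\<in>K. \<exists>l2\<in>K. \<exists>m1\<in>K. \<exists>m2\<in>K.
          a = l1 * m1 \<and> b = l1 * m2 + l2 * m1 \<and> c = l2 * m2)"

text \<open>Quadratic forms over the subfield \<open>K\<close> that define an elliptic quadric of the
  three-dimensional space over \<open>K\<close>, by their canonical form \<open>f(X\<^sub>1, X\<^sub>2) + X\<^sub>3 X\<^sub>4\<close> with \<open>f\<close>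
  irreducible over \<open>K\<close>.\<close>

definition elliptic_over :: "'a::field set \<Rightarrow> 'a ^ 4 ^ 4 \<Rightarrow> bool" where
  "elliptic_over K C \<longleftrightarrow>
     (\<forall>i j. C $ i $ j \<in> K) \<and>
     (\<exists>M :: 'a ^ 4 ^ 4. invertible M \<and> (\<forall>i j. M $ i $ j \<in> K) \<and>
        (\<exists>a\<in>K. \<exists>b\<in>K. \<exists>c\<in>K. irreducible_binary K a b c \<and>
           (\<forall>x. quad_form C (M *v x) =
              a * (x $ 1)\<^sup>2 + b * x $ 1 * x $ 2 + c * (x $ 2)\<^sup>2 + x $ 3 * x $ 4)))"

text \<open>\<open>\<Omega>\<close> is an elliptic quadric of the subgeometry \<open>\<Sigma>\<close>, in the coordinates over the
  subfield that \<open>\<Sigma>\<close> receives from the canonical subgeometry.\<close>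

definition elliptic_quadric_of ::
    "nat \<Rightarrow> ('a::field ^ 4) set set \<Rightarrow> ('a ^ 4) set set \<Rightarrow> bool" where
  "elliptic_quadric_of q \<Sigma> \<Omega> \<longleftrightarrow>
     (\<exists>g C. collineation g \<and> \<Sigma> = g ` canonical_subgeometry q \<and>
        elliptic_over (GF_sub q) C \<and> \<Omega> = g ` (canonical_subgeometry q \<inter> quadric C))"

end

theory Submission
  imports Defs "HOL-Number_Theory.Residues"
begin

text \<open>
  Normalise the quadratic form \<open>Q\<close>, with polar form \<open>b\<close>, so that \<open>b(p, x) = - h(x, p)\<close>, where \<open>h\<close>
  is the Hermitian form and \<open>P = \<langle>p\<rangle>\<close>. There is a common point \<open>\<langle>r\<rangle>\<close> off the tangent plane, scaled to
  \<open>h(r, p) = 1\<close>. Put \<open>U = {p, r}\<^sup>\<bottom>\<close>. The common points off the tangent plane are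
  \<open>r + u + (Q u + b(r, u)) p\<close> where \<open>u \<in> U\<close> is a zero of \<open>Tr (Q u + b(r, u)) + h(u, u)\<close>, a quadratic
  function of four variables over \<open>GF(q)\<close>. Counting along lines, such a function has more than
  \<open>q\<^sup>2\<close> zeros if its linear part does not vanish, or if it has a zero outside its radical. Hence
  \<open>b(r, u) = 0\<close> on \<open>U\<close> and the zeros form the radical \<open>W = {u \<in> U. \<forall>v\<in>U. b(u, v) = - h(v, u)}\<close>. Exchanging
  \<open>u\<close> and \<open>v\<close> in this equation shows that \<open>b\<close> takes values in \<open>GF(q)\<close> on \<open>W\<close>, and \<open>W\<close> has \<open>q\<^sup>2\<close>
  elements and spans \<open>U\<close>. So \<open>W\<close>, \<open>r\<close> and \<open>p\<close> span a Baer subgeometry on which \<open>h(x, x) = - 2 Q x\<close>, and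
  \<open>Q\<close> is anisotropic on \<open>W\<close>. Its discriminant on \<open>W\<close> lies in \<open>GF(q)\<close>, thus is a square in \<open>GF(q\<^sup>2)\<close>, so \<open>Q\<close>
  splits over \<open>GF(q\<^sup>2)\<close>.
\<close>

subsection \<open>The field of order \<open>q\<^sup>2\<close> over its subfield of order \<open>q\<close>\<close>

text \<open>Multiplication by a nonzero \<open>x\<close> permutes the nonzero elements, so comparing
  the two products over them gives \<open>x ^ (CARD('a) - 1) = 1\<close>.\<close>

lemma power_card_UNIV_eq_self:
  fixes x :: "'a::{field,finite}"
  shows "x ^ CARD('a) = x"
proof (cases "x = 0")
  case False
  have "bij_betw ((*) x) (UNIV - {0}) (UNIV - {0})"
    by (rule bij_betw_byWitness[where f' = "\<lambda>y. y / x"]) (use False in auto)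
  then have "(\<Prod>y\<in>UNIV-{0}. y) = (\<Prod>y\<in>UNIV-{0}. x * y)"
    using prod.reindex_bij_betw[of "(*) x" "UNIV - {0}" "UNIV - {0}" "\<lambda>y. y"] by simp
  also have "\<dots> = x ^ (CARD('a) - 1) * (\<Prod>y\<in>UNIV-{0}. y)"
    by (simp add: prod.distrib)
  finally have "x ^ (CARD('a) - 1) = 1"
    by simp
  then have "x * x ^ (CARD('a) - 1) = x"
    by simp
  then show ?thesis
    by (metis Suc_diff_1 power_Suc zero_less_card_finite)
qed simp

text \<open>The cardinality forces the characteristic to be the prime below \<open>q\<close>, so
  raising to the power \<open>q\<close> is an iterate of the Frobenius map.\<close>

lemma power_add_of_primepow_card:
  fixes x y :: "'a::{field,finite}"
  assumes "primepow q" and "CARD('a) = q\<^sup>2"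
  shows "(x + y) ^ q = x ^ q + y ^ q"
proof -
  have pr: "prime CHAR('a)"
    using prime_CHAR_semidom[where ?'a = 'a] finite_imp_CHAR_pos[where ?'a = 'a] by simp
  obtain c k where c: "prime c" "k > 0" "q = c ^ k"
    using assms(1) by (auto simp: primepow_def)
  have "CHAR('a) dvd c ^ (2 * k)"
    using CHAR_dvd_CARD[where ?'a = 'a] assms(2) c by (simp add: power_mult mult.commute)
  then have "CHAR('a) dvd c"
    using pr prime_dvd_power by blast
  then have "CHAR('a) = c"
    using pr c(1) primes_dvd_imp_eq by blast
  then show ?thesis
    using freshmans_dream'[OF pr, of q k x y] c by simp
qed

locale square_order_field =
  fixes q :: nat and ty :: "'a::{field,finite} itself"
  assumes primepow_q: "primepow q" and odd_q: "odd q" and card_field: "CARD('a) = q\<^sup>2"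
begin

abbreviation K :: "'a set" where "K \<equiv> GF_sub q"

text \<open>The relative trace from GF(q^2) to GF(q).\<close>

definition tr :: "'a \<Rightarrow> 'a" where "tr x = x + x ^ q"

lemma q_ge_3: "q \<ge> 3"
  using primepow_gt_Suc_0[OF primepow_q] odd_q by (cases "q = 2") auto

lemma q_pos: "q > 0"
  using q_ge_3 by simp

lemma conj_add: "(x + y) ^ q = x ^ q + (y::'a) ^ q"
  using power_add_of_primepow_card[OF primepow_q card_field] .

lemma conj_minus: "(- x) ^ q = - ((x::'a) ^ q)"
  using odd_q by simp

lemma conj_diff: "(x - y) ^ q = x ^ q - (y::'a) ^ q"
  using conj_add[of x "- y"] conj_minus by simp

lemma conj_conj: "((x::'a) ^ q) ^ q = x"
  using power_card_UNIV_eq_self[of x] by (simp add: card_field power_mult power2_eq_square)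

lemma two_neq_zero: "(2::'a) \<noteq> 0"
proof
  assume "(2::'a) = 0"
  then have "CHAR('a) dvd 2"
    using of_nat_eq_0_iff_char_dvd[where ?'a = 'a, of 2] by simp
  moreover have "prime CHAR('a)"
    using prime_CHAR_semidom[where ?'a = 'a] finite_imp_CHAR_pos[where ?'a = 'a] by simp
  ultimately have "CHAR('a) = 2"
    by (metis prime_nat_iff two_is_prime_nat not_prime_1)
  then have "2 dvd q\<^sup>2"
    using CHAR_dvd_CARD[where ?'a = 'a] card_field by simp
  then show False
    using odd_q by simp
qed

lemma K_iff: "x \<in> K \<longleftrightarrow> x ^ q = x"
  by (simp add: GF_sub_def)

lemma K_closed:
  "0 \<in> K" "1 \<in> K"
  "x \<in> K \<Longrightarrow> y \<in> K \<Longrightarrow> x + y \<in> K"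
  "x \<in> K \<Longrightarrow> y \<in> K \<Longrightarrow> x - y \<in> K"
  "x \<in> K \<Longrightarrow> - x \<in> K"
  "x \<in> K \<Longrightarrow> y \<in> K \<Longrightarrow> x * y \<in> K"
  "x \<in> K \<Longrightarrow> y \<in> K \<Longrightarrow> x / y \<in> K"
  "x \<in> K \<Longrightarrow> x ^ n \<in> K"
  "numeral k \<in> K"
proof -
  have "of_nat m \<in> K" for m
    using q_pos by (induction m) (auto simp: K_iff conj_add)
  then show "numeral k \<in> K"
    by (metis of_nat_numeral)
  show "x \<in> K \<Longrightarrow> x ^ n \<in> K"
    by (simp add: K_iff) (metis power_commutes power_mult mult.commute)
qed (use q_pos in \<open>auto simp: K_iff conj_add conj_diff conj_minus power_mult_distrib power_divide\<close>)

lemma tr_in_K: "tr x \<in> K"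
  by (simp add: K_iff tr_def conj_add conj_conj add.commute)

lemma tr_add: "tr (x + y) = tr x + tr y"
  by (simp add: tr_def conj_add)

lemma tr_scale: "c \<in> K \<Longrightarrow> tr (c * x) = c * tr x"
  by (simp add: tr_def K_iff power_mult_distrib algebra_simps)

lemma tr_0: "tr 0 = 0"
  using q_pos by (simp add: tr_def)

text \<open>The leading term is split off so that the polynomial is visibly nonzero of degree
  \<open>n\<close>; all bounds on fibres below come from this one.\<close>

lemma card_roots_monic_le:
  assumes "degree r < n" and "\<And>x::'a. x \<in> S \<Longrightarrow> x ^ n + poly r x = 0"
  shows "card S \<le> n"
proof -
  let ?f = "Polynomial.monom 1 n + r"
  have deg: "degree ?f = n"
    using assms(1) by (subst degree_add_eq_left) (auto simp: degree_monom_eq)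
  then have "?f \<noteq> 0"
    using assms(1) by force
  then have "card {x. poly ?f x = 0} \<le> n"
    using card_poly_roots_bound deg by metis
  moreover have "card S \<le> card {x. poly ?f x = 0}"
    using assms(2) by (intro card_mono) (auto simp: poly_monom)
  ultimately show ?thesis
    by simp
qed

text \<open>Fibres of \<open>tr\<close> are root sets of \<open>X^q + X - c\<close>, so they have at
  most \<open>q\<close> elements and the image has at least \<open>q\<close>. The image lies in
  \<open>K\<close>, which has at most \<open>q\<close> elements as the root set of
  \<open>X^q - X\<close>; hence both bounds are attained.\<close>

lemma card_K_and_range_tr: "card K = q \<and> range tr = K"
proof -
  have "card K \<le> q"
    by (rule card_roots_monic_le[of "[:0, -1:]"]) (use q_ge_3 in \<open>auto simp: K_iff\<close>)
  have fib: "card {x. tr x = c} \<le> q" for c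
    by (rule card_roots_monic_le[of "[:-c, 1:]"]) (use q_ge_3 in \<open>auto simp: tr_def\<close>)
  have "q * q = card (\<Union>c\<in>range tr. {x. tr x = c})"
  proof -
    have "(\<Union>c\<in>range tr. {x. tr x = c}) = UNIV"
      by auto
    then show ?thesis
      by (simp add: card_field power2_eq_square)
  qed
  also have "\<dots> \<le> (\<Sum>c\<in>range tr. card {x. tr x = c})"
    by (rule card_UN_le) simp
  also have "\<dots> \<le> card (range tr) * q"
    using sum_bounded_above[of "range tr" "\<lambda>c. card {x. tr x = c}" q] fib by simp
  finally have "q \<le> card (range tr)"
    using q_pos by simp
  moreover have "range tr \<subseteq> K"
    using tr_in_K by auto
  ultimately show ?thesis
    using \<open>card K \<le> q\<close> card_mono[of K "range tr"] card_subset_eq[of K "range tr"] by auto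
qed

lemmas card_K = card_K_and_range_tr[THEN conjunct1]

lemma tr_surj: "y \<in> K \<Longrightarrow> \<exists>x. tr x = y"
  using card_K_and_range_tr by (metis imageE)

text \<open>For nonzero \<open>x\<close> the products \<open>c * x\<close> run through the whole
  field, on which \<open>tr\<close> is not identically zero.\<close>

lemma tr_nondegenerate:
  assumes "\<And>c. tr (c * x) = 0"
  shows "x = 0"
proof (rule ccontr)
  assume "x \<noteq> 0"
  then have "tr c = 0" for c
    using assms[of "c / x"] by simp
  then show False
    using tr_surj[of 1] K_closed(2) by auto
qed

lemma ex_not_K: "\<exists>x::'a. x ^ q \<noteq> x"
proof (rule ccontr)
  assume "\<not> ?thesis"
  then have "K = UNIV"
    by (auto simp: K_iff)
  then have "q\<^sup>2 = q"
    using card_K card_field by simp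
  then show False
    using q_ge_3 by (simp add: power2_eq_square)
qed

text \<open>Euler's criterion: the squares already exhaust the roots of \<open>X\<^bsup>(q\<^sup>2-1)/2\<^esup> - 1\<close>.\<close>

lemma K_square:
  assumes "d \<in> K"
  shows "\<exists>s::'a. s\<^sup>2 = d"
proof (cases "d = 0")
  case False
  define m where "m = (q\<^sup>2 - 1) div 2"
  obtain j where j: "q = 2 * j + 1"
    using odd_q oddE by blast
  \<comment> \<open>The factor \<open>q - 1\<close> of \<open>m\<close> is what later gives
    \<open>d ^ m = 1\<close> for nonzero \<open>d \<in> K\<close>, because
    \<open>d ^ (q - 1) = 1\<close>.\<close>
  have m2: "2 * m = q\<^sup>2 - 1" "m = (q - 1) * (j + 1)"
    by (auto simp: m_def j power2_eq_square algebra_simps)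
  have m0: "m > 0"
    using m2(2) q_ge_3 by simp
  have unit: "x ^ (q\<^sup>2 - 1) = 1" if "x \<noteq> 0" for x :: 'a
  proof -
    have "x * x ^ (q\<^sup>2 - 1) = x"
      using power_card_UNIV_eq_self[of x] card_field q_pos
      by (metis Suc_diff_1 power_Suc zero_less_power)
    then show ?thesis
      using that by simp
  qed
  let ?S = "(\<lambda>x::'a. x\<^sup>2) ` (UNIV - {0})" and ?R = "{x::'a. x ^ m = 1}"
  have "card ?R \<le> m"
    by (rule card_roots_monic_le[of "[:-1:]"]) (use m0 in auto)
  have sub: "?S \<subseteq> ?R"
    using unit by (auto simp: m2(1) simp flip: power_mult)
  \<comment> \<open>Squaring has fibres of at most two elements, so there are at least
    \<open>m\<close> nonzero squares.\<close>
  have "q\<^sup>2 - 1 = card (\<Union>c\<in>?S. {x. x\<^sup>2 = c})"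
  proof -
    have "(\<Union>c\<in>?S. {x. x\<^sup>2 = c}) = UNIV - {0}"
      by auto
    then show ?thesis
      by (simp add: card_field card_Diff_singleton)
  qed
  also have "\<dots> \<le> (\<Sum>c\<in>?S. card {x. x\<^sup>2 = c})"
    by (rule card_UN_le) simp
  also have "\<dots> \<le> card ?S * 2"
    using sum_bounded_above[of ?S "\<lambda>c. card {x. x\<^sup>2 = c}" 2]
      card_roots_monic_le[of "[:-c:]" 2 "{x. x\<^sup>2 = c}" for c] by simp
  finally have "m \<le> card ?S"
    using m2 by simp
  then have "?S = ?R"
    using card_seteq[OF _ sub] \<open>card ?R \<le> m\<close> by simp
  moreover have "d \<in> ?R"
  proof -
    have "d * d ^ (q - 1) = d"
      using assms q_pos by (metis K_iff Suc_diff_1 power_Suc)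
    then have "d ^ (q - 1) = 1"
      using False by simp
    then show ?thesis
      unfolding mem_Collect_eq m2(2) power_mult by simp
  qed
  ultimately show ?thesis
    by (metis (no_types, lifting) imageE)
qed auto

end

subsection \<open>Counting zeros of quadratic functions\<close>

text \<open>Double counting of the pairs \<open>(u, t)\<close> with \<open>f t u \<in> Z\<close>:
  for fixed \<open>t\<close> the bijection \<open>f t\<close> turns the count into
  \<open>card (S \<inter> Z)\<close>.\<close>

lemma sum_card_orbit_hits:
  assumes "finite S" and "finite T" and "\<And>t. t \<in> T \<Longrightarrow> bij_betw (f t) S S"
  shows "(\<Sum>u\<in>S. card {t \<in> T. f t u \<in> Z}) = card T * card (S \<inter> Z)"
proof -
  have "(\<Sum>u\<in>S. card {t \<in> T. f t u \<in> Z}) = (\<Sum>u\<in>S. \<Sum>t\<in>T. of_bool (f t u \<in> Z))"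
    using assms(2) by (simp add: Int_def)
  also have "\<dots> = (\<Sum>t\<in>T. \<Sum>u\<in>S. of_bool (f t u \<in> Z))"
    by (rule sum.swap)
  also have "\<dots> = (\<Sum>t\<in>T. \<Sum>u\<in>S. of_bool (u \<in> Z))"
    by (rule sum.cong[OF refl], rule sum.reindex_bij_betw, rule assms(3))
  also have "\<dots> = card T * card (S \<inter> Z)"
    using assms(1) by simp
  finally show ?thesis .
qed

lemma Collect_eq_singletonI:
  assumes "c \<in> A" and "\<And>t. t \<in> A \<Longrightarrow> P t \<longleftrightarrow> t = c"
  shows "{t \<in> A. P t} = {c}"
  using assms by auto

text \<open>A four-dimensional quadratic space over GF(q) living inside a vector space over GF(q^2):
  scalars are restricted to \<open>K\<close>, and the dimension is expressed by
  \<open>card U = q ^ 4\<close>.\<close>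

locale quadratic_space = square_order_field q ty for q and ty :: "'a::{field,finite} itself" +
  fixes U :: "('a ^ 'n) set" and g :: "'a ^ 'n \<Rightarrow> 'a" and \<beta> :: "'a ^ 'n \<Rightarrow> 'a ^ 'n \<Rightarrow> 'a"
  assumes U_add: "u \<in> U \<Longrightarrow> v \<in> U \<Longrightarrow> u + v \<in> U"
    and U_scale: "t \<in> K \<Longrightarrow> u \<in> U \<Longrightarrow> t *s u \<in> U"
    and card_U: "card U = q ^ 4"
    and g_in_K: "u \<in> U \<Longrightarrow> g u \<in> K"
    and g_add: "u \<in> U \<Longrightarrow> v \<in> U \<Longrightarrow> g (u + v) = g u + g v + \<beta> u v"
    and g_scale: "t \<in> K \<Longrightarrow> u \<in> U \<Longrightarrow> g (t *s u) = t\<^sup>2 * g u"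
    and polar_in_K: "u \<in> U \<Longrightarrow> v \<in> U \<Longrightarrow> \<beta> u v \<in> K"
    and polar_add: "u \<in> U \<Longrightarrow> v \<in> U \<Longrightarrow> w \<in> U \<Longrightarrow> \<beta> u (v + w) = \<beta> u v + \<beta> u w"
    and polar_scale: "t \<in> K \<Longrightarrow> u \<in> U \<Longrightarrow> v \<in> U \<Longrightarrow> \<beta> u (t *s v) = t * \<beta> u v"
begin

definition functional :: "('a ^ 'n \<Rightarrow> 'a) \<Rightarrow> bool" where
  "functional l \<longleftrightarrow> (\<forall>u\<in>U. l u \<in> K) \<and> (\<forall>u\<in>U. \<forall>v\<in>U. l (u + v) = l u + l v) \<and>
     (\<forall>t\<in>K. \<forall>u\<in>U. l (t *s u) = t * l u)"

lemma functionalD: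
  assumes "functional l"
  shows "u \<in> U \<Longrightarrow> l u \<in> K" "u \<in> U \<Longrightarrow> v \<in> U \<Longrightarrow> l (u + v) = l u + l v"
    "t \<in> K \<Longrightarrow> u \<in> U \<Longrightarrow> l (t *s u) = t * l u"
  using assms by (auto simp: functional_def)

lemma functional_polar: "u \<in> U \<Longrightarrow> functional (\<beta> u)"
  by (simp add: functional_def polar_in_K polar_add polar_scale)

lemma zero_in_U: "0 \<in> U"
proof -
  have "U \<noteq> {}"
    using card_U q_pos by auto
  then show ?thesis
    using U_scale[OF K_closed(1)] by auto
qed

text \<open>Double counting for the translations by \<open>K\<close>-multiples of \<open>d\<close>;
  it reduces counting in \<open>S\<close> to counting on lines of one direction.\<close>

lemma sum_card_line_hits:
  assumes "S \<subseteq> U" and "\<And>u t. u \<in> S \<Longrightarrow> t \<in> K \<Longrightarrow> u + t *s d \<in> S"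
  shows "(\<Sum>u\<in>S. card {t \<in> K. u + t *s d \<in> Z}) = q * card (S \<inter> Z)"
proof -
  have "bij_betw (\<lambda>u. u + t *s d) S S" if "t \<in> K" for t
    by (rule bij_betw_byWitness[where f' = "\<lambda>u. u + (- t) *s d"])
      (use assms(2)[OF _ that] assms(2)[OF _ K_closed(5)[OF that]] in
        \<open>auto simp: vector_smult_lneg\<close>)
  then show ?thesis
    using sum_card_orbit_hits[of S K "\<lambda>t u. u + t *s d" Z] by (simp add: card_K)
qed

text \<open>The same count for punctured lines through the origin.\<close>

lemma sum_card_multiple_hits:
  assumes "S \<subseteq> U" and "\<And>u t. u \<in> S \<Longrightarrow> t \<in> K \<Longrightarrow> t \<noteq> 0 \<Longrightarrow> t *s u \<in> S"
  shows "(\<Sum>u\<in>S. card {t \<in> K - {0}. t *s u \<in> Z}) = (q - 1) * card (S \<inter> Z)"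
proof -
  have "bij_betw (\<lambda>u. t *s u) S S" if "t \<in> K - {0}" for t
    by (rule bij_betw_byWitness[where f' = "\<lambda>u. (1 / t) *s u"])
      (use assms(2) that K_closed(7)[OF K_closed(2), of t] in \<open>auto simp: vector_smult_assoc\<close>)
  moreover have "card (K - {0}) = q - 1"
    using card_K K_closed(1) by simp
  ultimately show ?thesis
    using sum_card_orbit_hits[of S "K - {0}" "\<lambda>t u. t *s u" Z] by simp
qed

text \<open>Every line in a direction \<open>d\<close> with \<open>l d \<noteq> 0\<close> meets the
  kernel in exactly one point.\<close>

lemma card_functional_kernel:
  assumes l: "functional l" and d: "d \<in> U" "l d \<noteq> 0"
  shows "card {u \<in> U. l u = 0} = q ^ 3" "card {u \<in> U. l u \<noteq> 0} = q ^ 3 * (q - 1)"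
proof -
  have "card {t \<in> K. u + t *s d \<in> {u \<in> U. l u = 0}} = 1" if "u \<in> U" for u
  proof -
    have "u + t *s d \<in> {u \<in> U. l u = 0} \<longleftrightarrow> t = - l u / l d" if "t \<in> K" for t
      using that \<open>u \<in> U\<close> d functionalD[OF l]
      by (auto simp: U_add U_scale field_simps eq_neg_iff_add_eq_0)
    moreover have "- l u / l d \<in> K"
      using that d functionalD[OF l] K_closed(5,7) by blast
    ultimately have "{t \<in> K. u + t *s d \<in> {u \<in> U. l u = 0}} = {- l u / l d}"
      by blast
    then show ?thesis
      by simp
  qed
  then have "q * q ^ 3 = q * card (U \<inter> {u \<in> U. l u = 0})"
    using sum_card_line_hits[of U d "{u \<in> U. l u = 0}"] U_add U_scale d
    by (simp add: card_U power_Suc[symmetric] del: power_Suc)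
  moreover have "U \<inter> {u \<in> U. l u = 0} = {u \<in> U. l u = 0}"
    by auto
  ultimately have "q * card {u \<in> U. l u = 0} = q * q ^ 3"
    by metis
  then show ker: "card {u \<in> U. l u = 0} = q ^ 3"
    using q_pos by simp
  have "{u \<in> U. l u \<noteq> 0} = U - {u \<in> U. l u = 0}"
    by auto
  then have "card {u \<in> U. l u \<noteq> 0} = card U - card {u \<in> U. l u = 0}"
    by (simp add: card_Diff_subset)
  then show "card {u \<in> U. l u \<noteq> 0} = q ^ 3 * (q - 1)"
    using ker card_U by (simp add: numeral_eq_Suc algebra_simps)
qed

text \<open>As \<open>g v = 0\<close>, the function \<open>g (u + t *s v)\<close> is affine in
  \<open>t\<close> with slope \<open>\<beta> v u\<close>. So each line in direction \<open>v\<close>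
  with nonzero slope carries exactly one zero, which gives q^2 (q - 1) zeros.\<close>

lemma card_zeros_of_smooth_zero:
  assumes v: "v \<in> U" "g v = 0" and w: "w \<in> U" "\<beta> v w \<noteq> 0"
  shows "card {u \<in> U. g u = 0} > q\<^sup>2"
proof -
  let ?S = "{u \<in> U. \<beta> v u \<noteq> 0}" and ?Z = "{u \<in> U. g u = 0}"
  \<comment> \<open>\<open>\<beta> v v\<close> equals \<open>2 * g v\<close>; its vanishing keeps
    \<open>?S\<close> stable under translation by multiples of \<open>v\<close>.\<close>
  have polar_v: "\<beta> v v = 0"
  proof -
    have "g (v + v) = 2\<^sup>2 * g v"
      using g_scale[OF K_closed(9), of v "num.Bit0 num.One"] v(1)
      by (metis one_add_one vector_sadd_rdistrib vector_smult_lid)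
    then show ?thesis
      using g_add[OF v(1) v(1)] v(2) by simp
  qed
  have comm: "\<beta> u v = \<beta> v u" if "u \<in> U" for u
    using g_add[OF that v(1)] g_add[OF v(1) that] by (simp add: add.commute)
  have "card {t \<in> K. u + t *s v \<in> ?Z} = 1" if "u \<in> ?S" for u
  proof -
    have "u + t *s v \<in> ?Z \<longleftrightarrow> t = - g u / \<beta> v u" if "t \<in> K" for t
      using that \<open>u \<in> ?S\<close> v comm
      by (auto simp: U_add U_scale g_add g_scale polar_scale field_simps eq_neg_iff_add_eq_0)
    moreover have "- g u / \<beta> v u \<in> K"
      using that v g_in_K polar_in_K K_closed(5,7) by blast
    ultimately have "{t \<in> K. u + t *s v \<in> ?Z} = {- g u / \<beta> v u}"
      by blast
    then show ?thesis
      by simp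
  qed
  moreover have "u + t *s v \<in> ?S" if "u \<in> ?S" "t \<in> K" for u t
    using that v polar_v by (simp add: U_add U_scale polar_add polar_scale)
  ultimately have "card ?S = q * card (?S \<inter> ?Z)"
    using sum_card_line_hits[of ?S v ?Z] by simp
  then have "q * card (?S \<inter> ?Z) = q * (q\<^sup>2 * (q - 1))"
    using card_functional_kernel(2)[OF functional_polar[OF v(1)] w]
    by (auto simp: power2_eq_square power3_eq_cube mult.assoc)
  then have "card (?S \<inter> ?Z) = q\<^sup>2 * (q - 1)"
    using q_pos by simp
  moreover have "q\<^sup>2 * 2 \<le> q\<^sup>2 * (q - 1)"
    using q_ge_3 by (intro mult_left_mono) auto
  moreover have "card (?S \<inter> ?Z) \<le> card ?Z"
    by (rule card_mono) auto
  moreover have "q\<^sup>2 > 0"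
    using q_pos by simp
  ultimately show ?thesis
    by linarith
qed

text \<open>If \<open>g\<close> vanishes on the kernel of \<open>l\<close>, the kernel itself
  supplies q^3 zeros. Otherwise lines in a direction \<open>d\<close> of the kernel with
  \<open>g d \<noteq> 0\<close> show that \<open>g\<close> has few zeros off the kernel, and each
  other vector there has exactly one nonzero multiple that is a zero of
  \<open>g + l\<close>.\<close>

lemma card_zeros_of_nonzero_linear_part:
  assumes l: "functional l" and w: "w \<in> U" "l w \<noteq> 0"
  shows "card {u \<in> U. g u + l u = 0} > q\<^sup>2"
proof (cases "\<forall>d\<in>U. l d = 0 \<longrightarrow> g d = 0")
  case True
  then have "card {u \<in> U. l u = 0} \<le> card {u \<in> U. g u + l u = 0}"
    by (intro card_mono) auto
  then have "q ^ 3 \<le> card {u \<in> U. g u + l u = 0}"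
    using card_functional_kernel(1)[OF l w] by simp
  moreover have "q\<^sup>2 < q ^ 3"
    using q_ge_3 by (intro power_strict_increasing) auto
  ultimately show ?thesis
    by simp
next
  case False
  then obtain d where d: "d \<in> U" "l d = 0" "g d \<noteq> 0"
    by auto
  let ?S = "{u \<in> U. l u \<noteq> 0}" and ?X = "{u. g u = 0}" and ?Z = "{u \<in> U. g u + l u = 0}"
  note ld = functionalD[OF l]
  have cS: "card ?S = q ^ 3 * (q - 1)"
    by (rule card_functional_kernel(2)[OF l w])
  \<comment> \<open>Along a line in direction \<open>d\<close> the function \<open>g\<close> is a
    quadratic polynomial with leading coefficient \<open>g d\<close>, hence has at most two
    zeros.\<close>
  have two: "card {t \<in> K. u + t *s d \<in> ?X} \<le> 2" if "u \<in> ?S" for u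
  proof (rule card_roots_monic_le)
    show "degree [:g u / g d, \<beta> u d / g d:] < 2"
      by (auto simp: degree_pCons_eq_if)
    fix t assume "t \<in> {t \<in> K. u + t *s d \<in> ?X}"
    then have "t \<in> K" "g (u + t *s d) = 0"
      by auto
    then have "g u + t\<^sup>2 * g d + t * \<beta> u d = 0"
      using that d by (simp add: g_add g_scale polar_scale U_scale)
    then have "(g u + t\<^sup>2 * g d + t * \<beta> u d) / g d = 0"
      by simp
    then show "t\<^sup>2 + poly [:g u / g d, \<beta> u d / g d:] t = 0"
      using d(3) by (simp add: add_divide_distrib algebra_simps)
  qed
  have "q * card (?S \<inter> ?X) = (\<Sum>u\<in>?S. card {t \<in> K. u + t *s d \<in> ?X})"
    by (rule sum_card_line_hits[symmetric]) (use d ld U_add U_scale in auto)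
  also have "\<dots> \<le> card ?S * 2"
    using sum_bounded_above[of ?S "\<lambda>u. card {t \<in> K. u + t *s d \<in> ?X}" 2] two by simp
  finally have "q * card (?S \<inter> ?X) \<le> q * (2 * q\<^sup>2 * (q - 1))"
    using cS by (simp add: numeral_eq_Suc algebra_simps)
  then have SX: "card (?S \<inter> ?X) \<le> 2 * q\<^sup>2 * (q - 1)"
    using q_pos by simp
  \<comment> \<open>At \<open>t *s u\<close> the function \<open>g + l\<close> has the value
    \<open>t * (t * g u + l u)\<close>; since \<open>l u \<noteq> 0\<close>, a nonzero root
    \<open>t\<close> exists exactly when \<open>g u \<noteq> 0\<close>.\<close>
  have hits: "card {t \<in> K - {0}. t *s u \<in> ?Z} = of_bool (u \<notin> ?X)" if "u \<in> ?S" for u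
  proof -
    have u: "u \<in> U" "l u \<noteq> 0"
      using that by auto
    have iff: "t *s u \<in> ?Z \<longleftrightarrow> t * g u = - l u" if "t \<in> K" "t \<noteq> 0" for t
    proof -
      have "g (t *s u) + l (t *s u) = t * (t * g u + l u)"
        using that u by (simp add: g_scale ld power2_eq_square algebra_simps)
      then show ?thesis
        using that u U_scale by (simp add: eq_neg_iff_add_eq_0)
    qed
    show ?thesis
    proof (cases "g u = 0")
      case True
      then have empty: "{t \<in> K - {0}. t *s u \<in> ?Z} = {}"
        using iff u by auto
      show ?thesis
        unfolding empty using True by simp
    next
      case False
      have single: "{t \<in> K - {0}. t *s u \<in> ?Z} = {- l u / g u}"
      proof (rule Collect_eq_singletonI)
        have "- l u / g u \<in> K"
          using u ld(1) g_in_K K_closed(5,7) by blast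
        then show "- l u / g u \<in> K - {0}"
          using u(2) False by simp
      next
        fix t assume "t \<in> K - {0}"
        then show "t *s u \<in> ?Z \<longleftrightarrow> t = - l u / g u"
          using iff[of t] nonzero_eq_divide_eq[OF False, of t "- l u"] by simp
      qed
      show ?thesis
        unfolding single using False by simp
    qed
  qed
  have "(q - 1) * card (?S \<inter> ?Z) = (\<Sum>u\<in>?S. card {t \<in> K - {0}. t *s u \<in> ?Z})"
    by (rule sum_card_multiple_hits[symmetric]) (use ld U_scale in auto)
  also have "\<dots> = (\<Sum>u\<in>?S. of_bool (u \<notin> ?X))"
    by (rule sum.cong[OF refl hits])
  also have "\<dots> = card (?S - ?X)"
    by (simp add: Int_def set_diff_eq)
  also have "\<dots> = card ?S - card (?S \<inter> ?X)"
    by (simp add: card_Diff_subset_Int)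
  finally have "(q - 1) * card (?S \<inter> ?Z) \<ge> q ^ 3 * (q - 1) - 2 * q\<^sup>2 * (q - 1)"
    using SX cS by linarith
  then have "(q - 1) * (q ^ 3 - 2 * q\<^sup>2) \<le> (q - 1) * card (?S \<inter> ?Z)"
    by (simp only: diff_mult_distrib2 mult.commute[of "q - 1"])
  then have "q ^ 3 - 2 * q\<^sup>2 \<le> card (?S \<inter> ?Z)"
    using q_ge_3 unfolding mult_le_cancel1 by linarith
  moreover have "q\<^sup>2 * 3 \<le> q ^ 3"
    using mult_left_mono[OF q_ge_3, of "q\<^sup>2"] by (simp add: power2_eq_square power3_eq_cube)
  ultimately have "q\<^sup>2 \<le> card (?S \<inter> ?Z)"
    by linarith
  \<comment> \<open>For \<open>q = 3\<close> the estimate off the kernel gives only q^2; the zero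
    vector makes the inequality strict.\<close>
  moreover have "card (insert 0 (?S \<inter> ?Z)) \<le> card ?Z"
  proof (rule card_mono)
    have "g 0 = 0" "l 0 = 0"
      using g_scale[OF K_closed(1) zero_in_U] ld(3)[OF K_closed(1) zero_in_U] by auto
    then show "insert 0 (?S \<inter> ?Z) \<subseteq> ?Z"
      using zero_in_U by auto
  qed simp
  moreover have "0 \<notin> ?S"
    using ld(3)[OF K_closed(1) zero_in_U] by simp
  ultimately show ?thesis
    by simp
qed

end

subsection \<open>Projective points, collineations and forms\<close>

lemma span_singleton_eqD:
  fixes v w :: "'a::field ^ 'n"
  assumes "vec.span {v} = vec.span {w}"
  shows "\<exists>c. v = c *s w"
  using assms vec.span_base[of v "{v}"] by (auto simp: vec.span_singleton)

lemma span_singleton_scale: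
  fixes v :: "'a::field ^ 'n"
  assumes "c \<noteq> 0"
  shows "vec.span {c *s v} = vec.span {v}"
proof -
  have "k *s v \<in> range (\<lambda>k. k *s (c *s v))" for k
    by (rule image_eqI[of _ _ "k / c"]) (use assms in \<open>auto simp: vector_smult_assoc\<close>)
  then show ?thesis
    by (auto simp: vec.span_singleton vector_smult_assoc)
qed

lemma matrix_image_span_singleton:
  fixes M :: "'a::field ^ 'n ^ 'n"
  shows "(*v) M ` vec.span {v} = vec.span {M *v v}"
  using vec.linear_span_image[OF matrix_vector_mul_linear_gen, of M "{v}"] by simp

text \<open>An invertible linear map preserves dimensions of subspaces, and so does its
  inverse.\<close>

lemma collineation_matrix_image:
  fixes M :: "'a::field ^ 'n ^ 'n"
  assumes "invertible M"
  shows "collineation ((`) ((*v) M))"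
proof -
  obtain N where N: "M ** N = mat 1" "N ** M = mat 1"
    using assms by (auto simp: invertible_def)
  have inv: "N *v (M *v v) = v" "M *v (N *v v) = v" for v
    by (simp_all add: matrix_vector_mul_assoc N)
  \<comment> \<open>Stated for a general pair of matrices so that it serves for \<open>M\<close> and
    for its inverse \<open>N\<close>.\<close>
  have points: "(*v) M' ` X \<in> proj_points"
    if MN: "\<And>v. N' *v (M' *v v) = v" and X: "X \<in> proj_points" for M' N' :: "'a ^ 'n ^ 'n" and X
  proof -
    obtain v where v: "X = vec.span {v}" "v \<noteq> 0"
      using X by (auto simp: proj_points_def)
    then have "M' *v v \<noteq> 0"
      using MN[of v] by (metis matrix_vector_mult_0_right)
    then show ?thesis
      unfolding v(1) matrix_image_span_singleton by (auto simp: proj_points_def)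
  qed
  have bij: "bij_betw ((`) ((*v) M)) proj_points proj_points"
    by (rule bij_betw_byWitness[where f' = "(`) ((*v) N)"])
      (use points[of N M] points[of M N] inv in \<open>auto simp: image_image\<close>)
  have lines: "(`) ((*v) M') ` L \<in> proj_lines"
    if MN: "\<And>v. N' *v (M' *v v) = v" "\<And>v. M' *v (N' *v v) = v" and L: "L \<in> proj_lines"
    for M' N' :: "'a ^ 'n ^ 'n" and L
  proof -
    obtain S where S: "L = {P \<in> proj_points. P \<subseteq> S}" "vec.subspace S" "vec.dim S = 2"
      using L by (auto simp: proj_lines_def)
    have "vec.subspace ((*v) M' ` S)"
      using vec.linear_subspace_image[OF matrix_vector_mul_linear_gen S(2)] .
    moreover have "inj_on ((*v) M') (vec.span S)"
      using MN(1) by (metis inj_onI)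
    then have "vec.dim ((*v) M' ` S) = 2"
      using vec.dim_image_eq[OF matrix_vector_mul_linear_gen] S(3) by metis
    moreover have "(`) ((*v) M') ` L = {P \<in> proj_points. P \<subseteq> (*v) M' ` S}"
    proof (intro equalityI subsetI)
      fix P assume "P \<in> (`) ((*v) M') ` L"
      then show "P \<in> {P \<in> proj_points. P \<subseteq> (*v) M' ` S}"
        using points[of N' M'] MN(1) S(1) by auto
    next
      fix P assume P: "P \<in> {P \<in> proj_points. P \<subseteq> (*v) M' ` S}"
      then have "(*v) N' ` P \<in> proj_points"
        using points[of M' N'] MN(2) by auto
      moreover have "(*v) N' ` P \<subseteq> S"
        using P MN(1) by auto
      moreover have "P = (*v) M' ` ((*v) N' ` P)"
        using MN(2) by (simp add: image_image)
      ultimately show "P \<in> (`) ((*v) M') ` L"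
        using S(1) by blast
    qed
    ultimately show ?thesis
      by (auto simp: proj_lines_def)
  qed
  have "L \<in> proj_lines \<longleftrightarrow> (`) ((*v) M) ` L \<in> proj_lines" for L
  proof
    assume "(`) ((*v) M) ` L \<in> proj_lines"
    then have "(`) ((*v) N) ` ((`) ((*v) M) ` L) \<in> proj_lines"
      using lines[of M N] inv by blast
    then show "L \<in> proj_lines"
      by (simp add: image_image inv)
  qed (use lines[of N M] inv in blast)
  then show ?thesis
    using bij by (simp add: collineation_def)
qed

definition frame_matrix ::
    "'a::field ^ 4 \<Rightarrow> 'a ^ 4 \<Rightarrow> 'a ^ 4 \<Rightarrow> 'a ^ 4 \<Rightarrow> 'a ^ 4 ^ 4" where
  "frame_matrix v1 v2 v3 v4 =
     (\<chi> i j. (if j = 1 then v1 else if j = 2 then v2 else if j = 3 then v3 else v4) $ i)"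

lemma frame_matrix_mult:
  "frame_matrix v1 v2 v3 v4 *v x = x $ 1 *s v1 + x $ 2 *s v2 + x $ 3 *s v3 + x $ 4 *s v4"
  by (simp add: vec_eq_iff frame_matrix_def matrix_vector_mult_def sum_4 mult.commute)

lemma invertible_if_kernel_trivial:
  fixes M :: "'a::field ^ 'n ^ 'n"
  assumes "\<And>x. M *v x = 0 \<Longrightarrow> x = 0"
  shows "invertible M"
  using assms by (auto simp: invertible_left_inverse matrix_left_invertible_ker)

section \<open>Quadratic and Hermitian forms and their surfaces\<close>

text \<open>The polar form of \<open>quad_form B\<close>, written through the gradient because the
  tangent plane is defined by the gradient.\<close>

definition quad_polar :: "'a::field ^ 'n ^ 'n \<Rightarrow> 'a ^ 'n \<Rightarrow> 'a ^ 'n \<Rightarrow> 'a" where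
  "quad_polar B x y = (\<Sum>j\<in>UNIV. quad_gradient B x $ j * y $ j)"

lemma quad_polar_eq:
  "quad_polar B x y = (\<Sum>i\<in>UNIV. \<Sum>j\<in>UNIV. B $ i $ j * (x $ i * y $ j + y $ i * x $ j))"
proof -
  have "quad_polar B x y =
      (\<Sum>j\<in>UNIV. \<Sum>i\<in>UNIV. B $ i $ j * (x $ i * y $ j)) +
      (\<Sum>j\<in>UNIV. \<Sum>i\<in>UNIV. B $ j $ i * (y $ j * x $ i))"
    by (simp add: quad_polar_def quad_gradient_def sum_distrib_left sum_distrib_right algebra_simps
        sum.distrib)
  also have "(\<Sum>j\<in>UNIV. \<Sum>i\<in>UNIV. B $ i $ j * (x $ i * y $ j)) =
      (\<Sum>i\<in>UNIV. \<Sum>j\<in>UNIV. B $ i $ j * (x $ i * y $ j))"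
    by (rule sum.swap)
  finally show ?thesis
    by (simp add: algebra_simps sum.distrib)
qed

lemma quad_form_add: "quad_form B (x + y) = quad_form B x + quad_form B y + quad_polar B x y"
  by (simp add: quad_form_def quad_polar_eq algebra_simps sum.distrib)

lemma quad_form_scale: "quad_form B (c *s x) = c\<^sup>2 * quad_form B x"
  by (simp add: quad_form_def sum_distrib_left power2_eq_square algebra_simps)

lemma quad_polar_sym: "quad_polar B y x = quad_polar B x y"
  by (simp add: quad_polar_eq algebra_simps)

lemma quad_polar_add: "quad_polar B (x + y) z = quad_polar B x z + quad_polar B y z"
  by (simp add: quad_polar_eq algebra_simps sum.distrib)

lemma quad_polar_scale: "quad_polar B (c *s x) y = c * quad_polar B x y"
  by (simp add: quad_polar_eq sum_distrib_left algebra_simps)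

lemma quad_polar_add_right: "quad_polar B x (y + z) = quad_polar B x y + quad_polar B x z"
  by (metis quad_polar_add quad_polar_sym)

lemma quad_polar_scale_right: "quad_polar B x (c *s y) = c * quad_polar B x y"
  by (metis quad_polar_scale quad_polar_sym)

text \<open>By homogeneity one representative decides membership of a point.\<close>

lemma span_singleton_in_quadric_iff:
  assumes "v \<noteq> 0"
  shows "vec.span {v} \<in> quadric C \<longleftrightarrow> quad_form C v = 0"
proof -
  have "(\<forall>x\<in>vec.span {v}. quad_form C x = 0) \<longleftrightarrow> quad_form C v = 0"
    using vec.span_base[of v "{v}"] by (auto simp: vec.span_singleton quad_form_scale)
  then show ?thesis
    using assms by (auto simp: quadric_def proj_points_def)
qed

text \<open>Upper triangular, so that the mixed coefficient \<open>b\<close> need not be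
  halved.\<close>

definition elliptic_matrix :: "'a::field \<Rightarrow> 'a \<Rightarrow> 'a \<Rightarrow> 'a ^ 4 ^ 4" where
  "elliptic_matrix a b c =
     (\<chi> i j. if i = 1 \<and> j = 1 then a else if i = 1 \<and> j = 2 then b
       else if i = 2 \<and> j = 2 then c else if i = 3 \<and> j = 4 then 1 else 0)"

lemma quad_form_elliptic_matrix:
  "quad_form (elliptic_matrix a b c) x =
     a * (x $ 1)\<^sup>2 + b * x $ 1 * x $ 2 + c * (x $ 2)\<^sup>2 + x $ 3 * x $ 4"
  by (simp add: quad_form_def elliptic_matrix_def sum_4 power2_eq_square)

lemma herm_form_add_left: "herm_form q A (x + y) z = herm_form q A x z + herm_form q A y z"
  by (simp add: herm_form_def algebra_simps sum.distrib)

lemma herm_form_scale_left: "herm_form q A (c *s x) y = c * herm_form q A x y"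
  by (simp add: herm_form_def sum_distrib_left algebra_simps)

lemma herm_form_scale_right: "herm_form q A x (c *s y) = c ^ q * herm_form q A x y"
  by (simp add: herm_form_def sum_distrib_left power_mult_distrib algebra_simps)

context square_order_field
begin

lemma conj_sum: "(\<Sum>i\<in>S. f i :: 'a) ^ q = (\<Sum>i\<in>S. f i ^ q)"
  by (induction S rule: infinite_finite_induct) (use q_pos in \<open>auto simp: conj_add\<close>)

lemma herm_form_conj:
  fixes A :: "'a ^ 'n ^ 'n"
  assumes "hermitian_matrix q A"
  shows "herm_form q A y x = (herm_form q A x y) ^ q"
proof -
  have "(A $ i $ j) ^ q = A $ j $ i" for i j
    by (rule assms[unfolded hermitian_matrix_def, rule_format, symmetric])
  then have "(herm_form q A x y) ^ q =
      (\<Sum>i\<in>UNIV. \<Sum>j\<in>UNIV. A $ j $ i * y $ j * x $ i ^ q)"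
    by (simp add: herm_form_def conj_sum power_mult_distrib conj_conj mult_ac)
  also have "\<dots> = herm_form q A y x"
    unfolding herm_form_def by (rule sum.swap)
  finally show ?thesis ..
qed

text \<open>Evaluation at unit vectors shows that \<open>A\<close> annihilates the conjugate of
  \<open>y\<close>.\<close>

lemma herm_form_nondegenerate:
  fixes A :: "'a ^ 'n ^ 'n"
  assumes "invertible A" and "\<And>x. herm_form q A x y = 0"
  shows "y = 0"
proof -
  let ?z = "\<chi> j. y $ j ^ q"
  have "(A *v ?z) $ k = 0" for k
  proof -
    have "herm_form q A (axis k 1) y = (\<Sum>i\<in>UNIV. axis k 1 $ i * (\<Sum>j\<in>UNIV. A $ i $ j * y $ j ^ q))"
      by (simp add: herm_form_def sum_distrib_left algebra_simps)
    also have "\<dots> = (\<Sum>i\<in>UNIV. if i = k then \<Sum>j\<in>UNIV. A $ i $ j * y $ j ^ q else 0)"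
      by (rule sum.cong) (auto simp: axis_def)
    finally show ?thesis
      using assms(2) by (simp add: matrix_vector_mult_def)
  qed
  then have "A *v ?z = 0"
    by (simp add: vec_eq_iff)
  then have "?z = 0"
    using assms(1) by (metis invertible_left_inverse matrix_left_invertible_ker)
  then show ?thesis
    using q_pos by (simp add: vec_eq_iff)
qed

end

lemma span_singleton_in_hermitian_variety_iff:
  fixes v :: "'a::field ^ 'n"
  assumes "v \<noteq> 0"
  shows "vec.span {v} \<in> hermitian_variety q A \<longleftrightarrow> herm_form q A v v = 0"
proof -
  have "(\<forall>x\<in>vec.span {v}. herm_form q A x x = 0) \<longleftrightarrow> herm_form q A v v = 0"
    using vec.span_base[of v "{v}"]
    by (auto simp: vec.span_singleton herm_form_scale_left herm_form_scale_right)
  then show ?thesis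
    using assms by (auto simp: hermitian_variety_def proj_points_def)
qed

lemma span_singleton_in_hermitian_tangent_iff:
  fixes v p :: "'a::field ^ 'n"
  assumes "v \<noteq> 0"
  shows "vec.span {v} \<in> hermitian_tangent q A (vec.span {p}) \<longleftrightarrow> herm_form q A v p = 0"
proof -
  have "(\<forall>x\<in>vec.span {v}. \<forall>y\<in>vec.span {p}. herm_form q A x y = 0) \<longleftrightarrow> herm_form q A v p = 0"
    using vec.span_base[of v "{v}"] vec.span_base[of p "{p}"]
    by (auto simp: vec.span_singleton herm_form_scale_left herm_form_scale_right)
  then show ?thesis
    using assms by (auto simp: hermitian_tangent_def proj_points_def)
qed

lemma span_singleton_in_quadric_tangent_iff:
  fixes v p :: "'a::field ^ 'n"
  assumes "v \<noteq> 0"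
  shows "vec.span {v} \<in> quadric_tangent B (vec.span {p}) \<longleftrightarrow> quad_polar B p v = 0"
proof -
  have "quad_polar B (c *s p) (d *s v) = c * (d * quad_polar B p v)" for c d
    by (simp add: quad_polar_scale quad_polar_scale_right)
  then have "(\<forall>x\<in>vec.span {v}. \<forall>y\<in>vec.span {p}. quad_polar B y x = 0) \<longleftrightarrow> quad_polar B p v = 0"
    using vec.span_base[of v "{v}"] vec.span_base[of p "{p}"]
    by (auto simp: vec.span_singleton)
  then show ?thesis
    using assms by (auto simp: quadric_tangent_def proj_points_def quad_polar_def)
qed

subsection \<open>Common points of the two surfaces\<close>

text \<open>The two surfaces through their forms, with \<open>Q\<close> and \<open>b\<close> already
  rescaled: equal tangent planes at the point of \<open>p\<close> make \<open>b p x\<close> and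
  \<open>h x p\<close> proportional, and \<open>b_p\<close> fixes the factor to be -1.\<close>

locale tangent_pair = square_order_field q ty for q and ty :: "'a::{field,finite} itself" +
  fixes h b :: "'a ^ 4 \<Rightarrow> 'a ^ 4 \<Rightarrow> 'a" and Q :: "'a ^ 4 \<Rightarrow> 'a" and p :: "'a ^ 4"
  assumes h_add_left: "h (x + y) z = h x z + h y z"
    and h_scale_left: "h (c *s x) z = c * h x z"
    and h_conj: "h y x = (h x y) ^ q"
    and h_nondegenerate: "(\<And>x. h x y = 0) \<Longrightarrow> y = 0"
    and b_add_left: "b (x + y) z = b x z + b y z"
    and b_scale_left: "b (c *s x) z = c * b x z"
    and b_sym: "b y x = b x y"
    and Q_add: "Q (x + y) = Q x + Q y + b x y"
    and Q_scale: "Q (c *s x) = c\<^sup>2 * Q x"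
    and p_nonzero: "p \<noteq> 0"
    and h_pp: "h p p = 0"
    and Q_p: "Q p = 0"
    and b_p: "b p x = - h x p"
    and card_common: "card {vec.span {v} | v. v \<noteq> 0 \<and> h v v = 0 \<and> Q v = 0} = q\<^sup>2 + 1"
begin

abbreviation common :: "('a ^ 4) set set" where
  "common \<equiv> {vec.span {v} | v. v \<noteq> 0 \<and> h v v = 0 \<and> Q v = 0}"

lemma h_add_right: "h x (y + z) = h x y + h x z"
  by (metis h_conj h_add_left conj_add)

lemma h_scale_right: "h x (c *s y) = c ^ q * h x y"
  by (metis h_conj h_scale_left power_mult_distrib)

lemma b_add_right: "b x (y + z) = b x y + b x z"
  by (metis b_sym b_add_left)

lemma b_scale_right: "b x (c *s y) = c * b x y"
  by (metis b_sym b_scale_left)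

lemma h_minus: "h (- x) y = - h x y" "h x (- y) = - h x y"
  using h_scale_left[of "-1" x y] h_scale_right[of x "-1" y] odd_q
  by (simp_all add: vector_sneg_minus1[symmetric])

lemma h_diff: "h (x - y) z = h x z - h y z" "h x (y - z) = h x y - h x z"
  using h_add_left[of x "- y" z] h_add_right[of x y "- z"] by (simp_all add: h_minus)

lemmas form_simps = h_add_left h_scale_left h_add_right h_scale_right h_minus h_diff
  b_add_left b_scale_left b_add_right b_scale_right Q_add Q_scale

lemma h_0_iff: "h y x = 0 \<longleftrightarrow> h x y = 0"
  using h_conj[of y x] q_pos by simp

lemma h_self_in_K: "h x x \<in> K"
  using h_conj[of x x] by (simp add: K_iff)

lemma b_self: "b x x = 2 * Q x"
proof -
  have "2 *s x = x + x"
    by (metis one_add_one vector_sadd_rdistrib vector_smult_lid)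
  then have "2\<^sup>2 * Q x = Q x + Q x + b x x"
    using Q_scale[of 2 x] Q_add[of x x] by metis
  then show ?thesis
    by (simp add: algebra_simps)
qed

text \<open>A functional vanishing on the kernel of \<open>h t p\<close> is a multiple of it, and
  nondegeneracy carries this relation over to the vectors.\<close>

lemma perp_perp_p:
  assumes "\<And>t. h t p = 0 \<Longrightarrow> h t x = 0"
  shows "\<exists>c. x = c *s p"
proof -
  obtain s where s: "h s p \<noteq> 0"
    using h_nondegenerate p_nonzero by blast
  \<comment> \<open>The quotient is conjugated because \<open>h\<close> is conjugate-linear in its
    second argument.\<close>
  define c where "c = (h s x / h s p) ^ q"
  have "h t (x - c *s p) = 0" for t
  proof -
    have "h (t - (h t p / h s p) *s s) p = 0"
      using s by (simp add: form_simps)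
    then have "h (t - (h t p / h s p) *s s) x = 0"
      by (rule assms)
    then show ?thesis
      using s by (simp add: form_simps c_def conj_conj field_simps)
  qed
  then show ?thesis
    using h_nondegenerate by (metis eq_iff_diff_eq_0)
qed

text \<open>Otherwise some common point \<open>x \<noteq> p\<close> lies in the tangent plane. On the
  points \<open>s + \<lambda> x + \<mu> p\<close> the quadric determines \<open>\<mu>\<close>, and the Hermitian equation becomes a
  trace equation in \<open>\<lambda>\<close>, which is solvable for a suitable \<open>s\<close>.\<close>

lemma ex_common_off_tangent_plane: "\<exists>r. h r r = 0 \<and> Q r = 0 \<and> h r p = 1"
proof (rule ccontr)
  assume none: "\<not> ?thesis"
  have perp: "h v p = 0" if "h v v = 0" "Q v = 0" for v
  proof (rule ccontr)
    assume "h v p \<noteq> 0"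
    moreover define r where "r = (1 / h v p) *s v"
    ultimately have "h r r = 0 \<and> Q r = 0 \<and> h r p = 1"
      using that by (simp add: form_simps)
    then show False
      using none by blast
  qed
  have "\<not> common \<subseteq> {vec.span {p}}"
  proof
    assume "common \<subseteq> {vec.span {p}}"
    then have "card common \<le> 1"
      using card_mono[of "{vec.span {p}}" common] by simp
    then show False
      using card_common q_pos by simp
  qed
  then obtain x where x: "x \<noteq> 0" "h x x = 0" "Q x = 0" "vec.span {x} \<noteq> vec.span {p}"
    by auto
  have xp: "h x p = 0" "h p x = 0" "b x p = 0"
    using perp[OF x(2,3)] h_0_iff b_p[of x] b_sym[of p x] by auto
  have key: "h x s + b x s = 0" if s: "h s p = 1" for s
  proof (rule ccontr)
    define c where "c = h x s + b x s"
    assume "h x s + b x s \<noteq> 0"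
    then have c: "c \<noteq> 0"
      by (simp add: c_def)
    have ps: "h p s = 1" "b p s = -1" "b s p = -1"
      using s h_conj[of p s] b_p[of s] b_sym[of s p] by auto
    \<comment> \<open>With \<open>k * c = m\<close> the value \<open>h v v\<close> becomes
      \<open>h s s + tr (Q s) + tr m\<close>, which this choice makes zero.\<close>
    obtain m where m: "tr m = - (h s s + tr (Q s))"
      using tr_surj K_closed(3,5) h_self_in_K tr_in_K by metis
    define k where "k = m / c"
    \<comment> \<open>Since \<open>b s p = -1\<close>, this coefficient of \<open>p\<close> is the
      one that gives \<open>Q v = 0\<close>.\<close>
    define m' where "m' = Q s + k * b x s"
    define v where "v = s + k *s x + m' *s p"
    have "Q v = 0"
      using ps x xp Q_p b_sym[of s x] b_self[of p] by (simp add: v_def form_simps m'_def)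
    moreover have "h v v = 0"
    proof -
      have "h v v = h s s + tr (k * h x s) + tr m'"
        using s ps x xp h_pp h_conj[of s x]
        by (simp add: v_def form_simps tr_def power_mult_distrib algebra_simps)
      also have "tr m' = tr (Q s) + tr (k * b x s)"
        by (simp add: m'_def tr_add)
      also have "h s s + tr (k * h x s) + (tr (Q s) + tr (k * b x s)) =
          h s s + tr (Q s) + tr (k * c)"
        by (simp add: c_def ring_distribs tr_add)
      also have "k * c = m"
        using c by (simp add: k_def)
      finally show ?thesis
        using m by simp
    qed
    moreover have "h v p = 1"
      using s xp h_pp by (simp add: v_def form_simps)
    ultimately show False
      using none by blast
  qed
  obtain s0 where s0: "h s0 p \<noteq> 0"
    using h_nondegenerate p_nonzero by blast
  define s where "s = (1 / h s0 p) *s s0"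
  have s: "h s p = 1"
    using s0 by (simp add: s_def form_simps)
  obtain e :: 'a where e: "e ^ q \<noteq> e"
    using ex_not_K by blast
  have "h t x = 0" if t: "h t p = 0" for t
  proof -
    have lin: "h x t' + b x t' = 0" if "h t' p = 0" for t'
    proof -
      have "h x (s + t') + b x (s + t') = (h x s + b x s) + (h x t' + b x t')"
        by (simp add: form_simps)
      moreover have "h (s + t') p = 1"
        using s that by (simp add: form_simps)
      ultimately show ?thesis
        using key[of "s + t'"] key[OF s] by simp
    qed
    \<comment> \<open>Replacing \<open>t\<close> by \<open>e *s t\<close> multiplies the Hermitian
      term by \<open>e ^ q\<close> and the bilinear one by \<open>e\<close>; as these differ, both
      terms vanish.\<close>
    have "h x t + b x t = 0" "e ^ q * h x t + e * b x t = 0"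
      using lin[of t] lin[of "e *s t"] t by (auto simp: form_simps)
    moreover have "(e ^ q - e) * h x t = (e ^ q * h x t + e * b x t) - e * (h x t + b x t)"
      by (simp add: algebra_simps)
    ultimately have "(e ^ q - e) * h x t = 0"
      by simp
    then show ?thesis
      using e h_0_iff by simp
  qed
  then obtain c where "x = c *s p"
    using perp_perp_p by blast
  then show False
    using x(1,4) span_singleton_scale[of c p] by (cases "c = 0") auto
qed

end

section \<open>Coordinates relative to two common points\<close>

locale tangent_pair_frame = tangent_pair +
  fixes r :: "'a ^ 4"
  assumes h_rr: "h r r = 0" and Q_r: "Q r = 0" and h_rp: "h r p = 1"
begin

text \<open>The complement of \<open>p\<close> and \<open>r\<close> with respect to
  \<open>h\<close>. By \<open>b_p\<close> it is also orthogonal to \<open>p\<close> for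
  \<open>b\<close>; orthogonality to \<open>r\<close> for \<open>b\<close> is a consequence of the
  count and is proved in \<open>b_r\<close>.\<close>

definition U :: "('a ^ 4) set" where "U = {u. h u p = 0 \<and> h u r = 0}"

lemma frame_values:
  "h p r = 1" "b p r = -1" "b r p = -1" "b p p = 0" "b r r = 0"
  using h_conj[of p r] h_rp b_p[of r] b_sym[of p r] b_self Q_p Q_r by auto

lemmas frame_simps = h_pp Q_p h_rr Q_r h_rp frame_values

lemma U_values:
  assumes "u \<in> U"
  shows "h u p = 0" "h u r = 0" "h p u = 0" "h r u = 0" "b p u = 0" "b u p = 0"
  using assms h_0_iff b_p[of u] b_sym[of u p] by (auto simp: U_def)

lemma U_add: "u \<in> U \<Longrightarrow> v \<in> U \<Longrightarrow> u + v \<in> U"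
  by (simp add: U_def form_simps)

lemma U_scale: "u \<in> U \<Longrightarrow> c *s u \<in> U"
  by (simp add: U_def form_simps)

lemma decompose: "\<exists>u\<in>U. v = h v p *s r + u + h v r *s p"
  by (rule bexI[of _ "v - h v p *s r - h v r *s p"])
    (simp_all add: U_def form_simps frame_simps)

lemma coordinates:
  assumes "u \<in> U"
  shows "h (\<alpha> *s r + u + \<beta> *s p) p = \<alpha>" "h (\<alpha> *s r + u + \<beta> *s p) r = \<beta>"
  using U_values[OF assms] by (simp_all add: form_simps frame_simps)

text \<open>The decomposition identifies the whole space with GF(q^2) x \<open>U\<close> x
  GF(q^2).\<close>

lemma card_U: "card U = q ^ 4"
proof -
  let ?f = "\<lambda>(\<alpha>, u, \<beta>). \<alpha> *s r + u + \<beta> *s p"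
  have "inj_on ?f (UNIV \<times> U \<times> UNIV)"
  proof (rule inj_onI)
    fix x y assume xy: "x \<in> UNIV \<times> U \<times> UNIV" "y \<in> UNIV \<times> U \<times> UNIV" "?f x = ?f y"
    obtain \<alpha> u \<beta> \<alpha>' u' \<beta>' where [simp]: "x = (\<alpha>, u, \<beta>)" "y = (\<alpha>', u', \<beta>')"
      by (metis prod_cases3)
    from xy have *: "u \<in> U" "u' \<in> U"
      and eq: "\<alpha> *s r + u + \<beta> *s p = \<alpha>' *s r + u' + \<beta>' *s p"
      by auto
    have "\<alpha> = \<alpha>'" "\<beta> = \<beta>'"
      using coordinates[OF *(1), of \<alpha> \<beta>] coordinates[OF *(2), of \<alpha>' \<beta>'] eq by auto
    then show "x = y"
      using eq by simp
  qed
  moreover have "?f ` (UNIV \<times> U \<times> UNIV) = UNIV"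
  proof -
    have "v \<in> ?f ` (UNIV \<times> U \<times> UNIV)" for v
    proof -
      obtain u where "u \<in> U" "v = h v p *s r + u + h v r *s p"
        using decompose by blast
      then show ?thesis
        by (intro image_eqI[of _ _ "(h v p, u, h v r)"]) auto
    qed
    then show ?thesis
      by blast
  qed
  ultimately have "CARD('a ^ 4) = card ((UNIV::'a set) \<times> U \<times> (UNIV::'a set))"
    using card_image[of ?f "UNIV \<times> U \<times> UNIV"] by simp
  then have "(q\<^sup>2) ^ 4 = q\<^sup>2 * (card U * q\<^sup>2)"
    by (simp add: card_cartesian_product card_field)
  moreover have "(q\<^sup>2) ^ 4 = q ^ 4 * q ^ 4"
    by (simp flip: power_mult power_add)
  moreover have "q\<^sup>2 * (card U * q\<^sup>2) = q ^ 4 * card U"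
    by (simp add: power2_eq_square power4_eq_xxxx)
  ultimately have "q ^ 4 * card U = q ^ 4 * q ^ 4"
    by metis
  then show ?thesis
    using q_pos unfolding mult_cancel1 by simp
qed

text \<open>Up to the linear term \<open>tr (b r u)\<close> this is the value of \<open>h\<close> at
  \<open>lift u\<close>.\<close>

definition g :: "'a ^ 4 \<Rightarrow> 'a" where "g u = tr (Q u) + h u u"

text \<open>The polar form of \<open>g\<close>, because
  \<open>h u v + h v u = tr (h v u)\<close>.\<close>

definition \<beta> :: "'a ^ 4 \<Rightarrow> 'a ^ 4 \<Rightarrow> 'a" where "\<beta> u v = tr (b u v + h v u)"

sublocale quad: quadratic_space q ty U g \<beta>
proof
  fix u v w t
  show "g (u + v) = g u + g v + \<beta> u v"
    using h_conj[of u v] by (simp add: g_def \<beta>_def form_simps tr_add) (simp add: tr_def)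
  show "g u \<in> K"
    by (simp add: g_def K_closed tr_in_K h_self_in_K)
  show "\<beta> u v \<in> K"
    by (simp add: \<beta>_def tr_in_K)
  show "\<beta> u (v + w) = \<beta> u v + \<beta> u w"
    by (simp add: \<beta>_def form_simps tr_add)
  assume t: "t \<in> K"
  then show "g (t *s u) = t\<^sup>2 * g u"
    using K_closed(8)[OF t, of 2]
    by (simp add: g_def form_simps tr_scale K_iff power2_eq_square algebra_simps)
  show "\<beta> u (t *s v) = t * \<beta> u v"
    using t by (simp add: \<beta>_def form_simps ring_distribs[symmetric] tr_scale)
qed (auto simp: U_add U_scale card_U)

text \<open>The coefficient of \<open>p\<close> is the unique one that puts a vector
  \<open>r + u + c *s p\<close> on the quadric.\<close>

definition lift :: "'a ^ 4 \<Rightarrow> 'a ^ 4" where "lift u = r + u + (Q u + b r u) *s p"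

lemma lift_common:
  assumes "u \<in> U"
  shows "Q (lift u) = 0" "h (lift u) (lift u) = g u + tr (b r u)" "h (lift u) p = 1"
  using U_values[OF assms]
  by (simp_all add: lift_def form_simps frame_simps g_def tr_def conj_add)

lemma span_lift_inj:
  assumes "u \<in> U" "v \<in> U" and eq: "vec.span {lift u} = vec.span {lift v}"
  shows "u = v"
proof -
  obtain c where c: "lift u = c *s lift v"
    using span_singleton_eqD[OF eq] by blast
  then have "c = 1"
    using lift_common(3)[OF assms(1)] lift_common(3)[OF assms(2)] by (simp add: h_scale_left)
  then have *: "1 *s r + u + (Q u + b r u) *s p = 1 *s r + v + (Q v + b r v) *s p"
    using c by (simp add: lift_def)
  then have "Q u + b r u = Q v + b r v"
    using coordinates(2)[OF assms(1), of 1] coordinates(2)[OF assms(2), of 1] by metis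
  then show ?thesis
    using * by simp
qed

lemma span_p_neq: "h v p \<noteq> 0 \<Longrightarrow> vec.span {v} \<noteq> vec.span {p}"
  using span_singleton_eqD[of v p] by (auto simp: form_simps frame_simps)

text \<open>Distinct zeros give distinct common points off the tangent plane, and the point of
  \<open>p\<close> is one further common point.\<close>

lemma card_affine_part_le: "card {u \<in> U. g u + tr (b r u) = 0} \<le> q\<^sup>2"
proof -
  let ?Z = "{u \<in> U. g u + tr (b r u) = 0}" and ?f = "\<lambda>u. vec.span {lift u}"
  have nz: "lift u \<noteq> 0" if "u \<in> U" for u
    using lift_common(3)[OF that] h_scale_left[of 0 0 p] by auto
  have "insert (vec.span {p}) (?f ` ?Z) \<subseteq> common"
    using p_nonzero h_pp Q_p lift_common nz by auto
  then have "card (insert (vec.span {p}) (?f ` ?Z)) \<le> q\<^sup>2 + 1"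
    unfolding card_common[symmetric] by (intro card_mono) auto
  moreover have "vec.span {p} \<notin> ?f ` ?Z"
    using span_p_neq lift_common(3) by force
  moreover have "card (?f ` ?Z) = card ?Z"
    by (rule card_image) (auto intro!: inj_onI span_lift_inj)
  ultimately show ?thesis
    by simp
qed

text \<open>Otherwise some multiple of \<open>u\<close> shows that \<open>tr (b r u)\<close> is a
  nonzero linear part, and there are more than q^2 zeros.\<close>

lemma b_r:
  assumes "u \<in> U"
  shows "b r u = 0"
proof (rule ccontr)
  assume "b r u \<noteq> 0"
  then obtain c where "tr (c * b r u) \<noteq> 0"
    using tr_nondegenerate by blast
  then have "tr (b r (c *s u)) \<noteq> 0" "c *s u \<in> U"
    using assms U_scale by (auto simp: form_simps)
  moreover have "quad.functional (\<lambda>u. tr (b r u))"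
    by (simp add: quad.functional_def tr_in_K form_simps tr_add tr_scale)
  ultimately have "card {u \<in> U. g u + tr (b r u) = 0} > q\<^sup>2"
    using quad.card_zeros_of_nonzero_linear_part by blast
  then show False
    using card_affine_part_le by simp
qed

lemma b_r': "u \<in> U \<Longrightarrow> b u r = 0"
  using b_r b_sym by metis

section \<open>The radical and its structure over GF(q)\<close>

text \<open>The radical of \<open>\<beta>\<close>: as
  \<open>\<beta> u (c *s v) = tr (c * (b u v + h v u))\<close>, vanishing for all \<open>c\<close>
  amounts to the stated equation.\<close>

definition W :: "('a ^ 4) set" where "W = {u \<in> U. \<forall>v\<in>U. b u v = - h v u}"

text \<open>On \<open>W\<close> one has \<open>2 * Q u = - h u u\<close>, and the trace doubles
  elements of \<open>K\<close>, so \<open>g u = 0\<close>. Conversely a zero outside the radical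
  would force more than q^2 zeros.\<close>

lemma W_eq_zeros: "W = {u \<in> U. g u = 0}"
proof -
  have "g u = 0" if "u \<in> W" for u
  proof -
    have "2 * Q u = - h u u"
      using that b_self[of u] by (auto simp: W_def)
    moreover have "2 * g u = tr (2 * Q u) + 2 * h u u"
      using tr_scale[OF K_closed(9)] by (simp add: g_def algebra_simps)
    ultimately have "2 * g u = 0"
      using h_self_in_K[of u] by (simp add: tr_def K_iff conj_minus)
    then show ?thesis
      using two_neq_zero by simp
  qed
  moreover have "u \<in> W" if u: "u \<in> U" "g u = 0" for u
  proof -
    have "b u v + h v u = 0" if "v \<in> U" for v
    proof (rule tr_nondegenerate)
      fix c
      have "{u \<in> U. g u + tr (b r u) = 0} = {u \<in> U. g u = 0}"
        using b_r tr_0 by auto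
      then have "\<beta> u (c *s v) = 0"
        using quad.card_zeros_of_smooth_zero[OF u U_scale[OF that]] card_affine_part_le by force
      then show "tr (c * (b u v + h v u)) = 0"
        by (simp add: \<beta>_def form_simps ring_distribs)
    qed
    then show ?thesis
      using u by (auto simp: W_def eq_neg_iff_add_eq_0)
  qed
  ultimately show ?thesis
    by (auto simp: W_def)
qed

text \<open>A nonzero such \<open>u\<close> would make the whole line joining its point to that of
  \<open>p\<close> common; with the point of \<open>r\<close> this yields q^2 + 2 common
  points.\<close>

lemma U_anisotropic:
  assumes "u \<in> U" "Q u = 0" "h u u = 0"
  shows "u = 0"
proof (rule ccontr)
  assume "u \<noteq> 0"
  have nz: "u + c *s p \<noteq> 0" for c
  proof
    assume *: "u + c *s p = 0"
    then have "h (u + c *s p) r = 0"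
      using h_scale_left[of 0 0 r] by simp
    then have "c = 0"
      using U_values[OF assms(1)] by (simp add: form_simps frame_simps)
    then show False
      using * \<open>u \<noteq> 0\<close> by simp
  qed
  let ?f = "\<lambda>c. vec.span {u + c *s p}"
  have inj: "inj ?f"
  proof (rule injI)
    fix c d assume "?f c = ?f d"
    then obtain e where e: "u + c *s p = e *s (u + d *s p)"
      using span_singleton_eqD by blast
    then have "h (u + c *s p) r = h (e *s (u + d *s p)) r"
      by simp
    then have "c = e * d"
      using U_values[OF assms(1)] by (simp add: form_simps frame_simps)
    with e have "(1 - e) *s u = 0"
      by (simp add: vector_ssub_ldistrib vector_sub_rdistrib vector_add_ldistrib vector_smult_assoc)
    then have "e = 1"
      using \<open>u \<noteq> 0\<close> by (metis vector_mul_eq_0 eq_iff_diff_eq_0)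
    then show "c = d"
      using \<open>c = e * d\<close> by simp
  qed
  have "insert (vec.span {r}) (insert (vec.span {p}) (range ?f)) \<subseteq> common"
  proof -
    have "r \<noteq> 0"
      using h_rp h_scale_left[of 0 0 p] by auto
    moreover have "Q (u + c *s p) = 0" "h (u + c *s p) (u + c *s p) = 0" for c
      using U_values[OF assms(1)] assms by (simp_all add: form_simps frame_simps)
    ultimately show ?thesis
      using p_nonzero h_pp Q_p h_rr Q_r nz by auto
  qed
  then have "card (insert (vec.span {r}) (insert (vec.span {p}) (range ?f))) \<le> q\<^sup>2 + 1"
    unfolding card_common[symmetric] by (intro card_mono) auto
  moreover have "card (range ?f) = q\<^sup>2"
    using card_image[OF inj] card_field by simp
  moreover have "vec.span {p} \<notin> range ?f"
  proof
    assume "vec.span {p} \<in> range ?f"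
    then obtain c where "vec.span {u + c *s p} = vec.span {p}"
      by auto
    then obtain d where "u + c *s p = d *s p"
      using span_singleton_eqD by blast
    then have "u + (c - d) *s p = 0"
      by (simp add: vector_sub_rdistrib algebra_simps)
    then show False
      using nz by blast
  qed
  moreover have "vec.span {r} \<notin> insert (vec.span {p}) (range ?f)"
  proof
    assume "vec.span {r} \<in> insert (vec.span {p}) (range ?f)"
    moreover have "vec.span {r} \<noteq> vec.span {p}"
      using span_p_neq h_rp by simp
    ultimately obtain c where "vec.span {r} = vec.span {u + c *s p}"
      by auto
    then obtain d where "r = d *s (u + c *s p)"
      using span_singleton_eqD by blast
    then show False
      using h_rp U_values[OF assms(1)] by (simp add: form_simps frame_simps)
  qed
  ultimately show False
    by simp
qed

lemma common_eq: "common = insert (vec.span {p}) ((\<lambda>u. vec.span {lift u}) ` W)"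
proof
  show "insert (vec.span {p}) ((\<lambda>u. vec.span {lift u}) ` W) \<subseteq> common"
  proof -
    have "lift u \<noteq> 0 \<and> h (lift u) (lift u) = 0 \<and> Q (lift u) = 0" if "u \<in> W" for u
      using that lift_common[of u] h_scale_left[of 0 0 p] b_r[of u] tr_0
      by (auto simp: W_eq_zeros)
    then show ?thesis
      using p_nonzero h_pp Q_p by auto
  qed
  show "common \<subseteq> insert (vec.span {p}) ((\<lambda>u. vec.span {lift u}) ` W)"
  proof
    fix X assume "X \<in> common"
    then obtain v where X: "X = vec.span {v}" and v: "v \<noteq> 0" "h v v = 0" "Q v = 0"
      by blast
    obtain u where u: "u \<in> U" "v = h v p *s r + u + h v r *s p"
      using decompose by blast
    show "X \<in> insert (vec.span {p}) ((\<lambda>u. vec.span {lift u}) ` W)"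
    proof (cases "h v p = 0")
      \<comment> \<open>In the tangent plane the coefficient of \<open>p\<close> affects neither
        form, so \<open>u\<close> itself is a common zero and vanishes by anisotropy.\<close>
      case True
      then have vu: "v = u + h v r *s p"
        using u by simp
      have "Q (u + h v r *s p) = Q u" "h (u + h v r *s p) (u + h v r *s p) = h u u"
        using U_values[OF u(1)] by (simp_all add: form_simps frame_simps)
      then have "Q u = 0" "h u u = 0"
        using vu v by metis+
      then have "u = 0"
        using U_anisotropic u(1) by blast
      then obtain c where c: "v = c *s p"
        using vu by auto
      then have "c \<noteq> 0"
        using v(1) by auto
      then show ?thesis
        using X span_singleton_scale[of c p] c by simp
    next
      case False
      define a where "a = h v p"
      define v' where "v' = (1 / a) *s v"
      \<comment> \<open>Off the tangent plane the coefficient of \<open>r\<close> can be scaled to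
        1, and the quadric then forces the coefficient of \<open>p\<close>.\<close>
      have a: "a \<noteq> 0"
        using False by (simp add: a_def)
      define w where "w = (1 / a) *s u"
      define c where "c = h v r / a"
      have w: "w \<in> U"
        using u U_scale by (simp add: w_def)
      have v': "v' = r + w + c *s p"
        unfolding v'_def
        by (subst u(2))
          (use a in \<open>simp add: vector_add_ldistrib vector_smult_assoc w_def c_def a_def[symmetric]\<close>)
      have zero: "Q v' = 0" "h v' v' = 0"
        using v by (simp_all add: v'_def form_simps)
      then have "c = Q w + b r w"
        using U_values[OF w] by (simp add: v' form_simps frame_simps)
      then have lw: "v' = lift w"
        by (simp add: v' lift_def)
      then have "g w = 0"
        using zero lift_common(2)[OF w] b_r[OF w] tr_0 by simp
      then have "w \<in> W"
        using w by (simp add: W_eq_zeros)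
      moreover have "X = vec.span {lift w}"
        using X a span_singleton_scale[of "1 / a" v] lw by (simp add: v'_def)
      ultimately show ?thesis
        by blast
    qed
  qed
qed

text \<open>Here the exact number of common points enters: all but the point of \<open>p\<close>
  correspond to elements of \<open>W\<close>.\<close>

lemma card_W: "card W = q\<^sup>2"
proof -
  have "W \<subseteq> U"
    by (auto simp: W_def)
  then have "card ((\<lambda>u. vec.span {lift u}) ` W) = card W"
    by (intro card_image inj_onI span_lift_inj) auto
  moreover have "vec.span {p} \<notin> (\<lambda>u. vec.span {lift u}) ` W"
    using span_p_neq lift_common(3) \<open>W \<subseteq> U\<close> by (force simp: subset_iff)
  ultimately have "card common = card W + 1"
    unfolding common_eq by simp
  then show ?thesis
    using card_common by simp
qed

lemma W_in_U: "w \<in> W \<Longrightarrow> w \<in> U"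
  by (simp add: W_def)

lemma W_b: "v \<in> U \<Longrightarrow> w \<in> W \<Longrightarrow> b w v = - h v w"
  by (simp add: W_def)

lemma W_add: "u \<in> W \<Longrightarrow> v \<in> W \<Longrightarrow> u + v \<in> W"
  by (simp add: W_def U_add form_simps)

text \<open>The equation defining \<open>W\<close> is linear in \<open>u\<close> on one side and
  conjugate-linear on the other; scalars with \<open>t ^ q = t\<close> preserve it.\<close>

lemma W_scale: "t \<in> K \<Longrightarrow> u \<in> W \<Longrightarrow> t *s u \<in> W"
  by (simp add: W_def U_scale form_simps K_iff)

text \<open>Both \<open>- h v u\<close> and \<open>- h u v\<close> equal \<open>b u v\<close>, and
  they are conjugate.\<close>

lemma b_W_in_K:
  assumes "u \<in> W" "v \<in> W"
  shows "b u v \<in> K"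
  using W_b[OF W_in_U[OF assms(2)] assms(1)] W_b[OF W_in_U[OF assms(1)] assms(2)]
    h_conj[of u v] b_sym[of u v]
  by (simp add: K_iff conj_minus)

lemma Q_W_in_K:
  assumes "u \<in> W"
  shows "Q u \<in> K"
proof -
  have "b u u / 2 \<in> K"
    by (rule K_closed(7)[OF b_W_in_K[OF assms assms] K_closed(9)])
  moreover have "b u u / 2 = Q u"
    unfolding b_self using two_neq_zero by simp
  ultimately show ?thesis
    by simp
qed

lemma h_W:
  assumes "u \<in> W"
  shows "h u u = - 2 * Q u"
  using W_b[OF W_in_U[OF assms] assms] b_self[of u] by simp

text \<open>The two vectors are independent over GF(q^2), not only over \<open>K\<close>. Their
  \<open>K\<close>-combinations are then q^2 distinct elements and exhaust \<open>W\<close>.\<close>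

lemma W_frame:
  obtains w1 w2 where "w1 \<in> W" "w2 \<in> W"
    and "\<And>x y. x *s w1 + y *s w2 = 0 \<Longrightarrow> x = 0 \<and> y = 0"
    and "\<And>w. w \<in> W \<Longrightarrow> \<exists>x\<in>K. \<exists>y\<in>K. w = x *s w1 + y *s w2"
proof -
  have "\<not> W \<subseteq> {0}"
  proof
    assume "W \<subseteq> {0}"
    then have "card W \<le> 1"
      using card_mono[of "{0}" W] by simp
    moreover have "3\<^sup>2 \<le> q\<^sup>2"
      using q_ge_3 by (intro power_mono) auto
    ultimately show False
      using card_W by simp
  qed
  then obtain w1 where w1: "w1 \<in> W" "w1 \<noteq> 0"
    by auto
  have "\<not> W \<subseteq> range (\<lambda>c. c *s w1)"
  proof
    assume sub: "W \<subseteq> range (\<lambda>c. c *s w1)"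
    have "card (range (\<lambda>c. c *s w1)) \<le> q\<^sup>2"
      using card_image_le[of "UNIV :: 'a set" "\<lambda>c. c *s w1"] card_field by simp
    then have W: "W = range (\<lambda>c. c *s w1)"
      using card_seteq[OF _ sub] card_W by simp
    obtain e :: 'a where e: "e ^ q \<noteq> e"
      using ex_not_K by blast
    have "h t w1 = 0" for t
    proof -
      obtain u where u: "u \<in> U" "t = h t p *s r + u + h t r *s p"
        using decompose by blast
      \<comment> \<open>If \<open>W\<close> were a full line over GF(q^2), it would admit the scalar
        \<open>e\<close> outside \<open>K\<close>; comparing the factors \<open>e\<close> and
        \<open>e ^ q\<close> gives \<open>h u w1 = 0\<close>.\<close>
      have "e *s w1 \<in> W"
        using W by auto
      then have "e * b w1 u = - (e ^ q * h u w1)"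
        using W_b[OF u(1), of "e *s w1"] by (simp add: form_simps)
      then have "e * h u w1 = e ^ q * h u w1"
        unfolding W_b[OF u(1) w1(1)] by simp
      then have "h u w1 = 0"
        using e by auto
      then show ?thesis
        using U_values[OF W_in_U[OF w1(1)]] by (subst u(2)) (simp add: form_simps)
    qed
    then show False
      using h_nondegenerate w1(2) by blast
  qed
  then obtain w2 where w2: "w2 \<in> W" "w2 \<notin> range (\<lambda>c. c *s w1)"
    by auto
  have indep: "x = 0 \<and> y = 0" if "x *s w1 + y *s w2 = 0" for x y
  proof (cases "y = 0")
    case True
    then show ?thesis
      using that w1(2) by simp
  next
    case False
    have "w2 = (1 / y) *s (y *s w2)"
      using False by (simp add: vector_smult_assoc)
    also have "y *s w2 = (- x) *s w1"
      using that by (simp add: vector_smult_lneg eq_neg_iff_add_eq_0 add.commute)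
    finally have "w2 = (1 / y * (- x)) *s w1"
      by (simp only: vector_smult_assoc)
    then show ?thesis
      using w2(2) by blast
  qed
  let ?f = "\<lambda>(x, y). x *s w1 + y *s w2"
  have "inj_on ?f (K \<times> K)"
  proof (rule inj_onI, clarify)
    fix x y x' y' assume "x *s w1 + y *s w2 = x' *s w1 + y' *s w2"
    then have "(x - x') *s w1 + (y - y') *s w2 = 0"
      by (simp add: vector_sub_rdistrib algebra_simps)
    then show "x = x' \<and> y = y'"
      using indep[of "x - x'" "y - y'"] by simp
  qed
  then have "card (?f ` (K \<times> K)) = q\<^sup>2"
    by (simp add: card_image card_cartesian_product card_K power2_eq_square)
  moreover have "?f ` (K \<times> K) \<subseteq> W"
    using w1(1) w2(1) by (auto simp: W_add W_scale)
  ultimately have "?f ` (K \<times> K) = W"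
    using card_W by (intro card_seteq) auto
  then have "\<exists>x\<in>K. \<exists>y\<in>K. w = x *s w1 + y *s w2" if "w \<in> W" for w
  proof -
    have "w \<in> ?f ` (K \<times> K)"
      using that \<open>?f ` (K \<times> K) = W\<close> by simp
    then obtain z where "z \<in> K \<times> K" "w = ?f z"
      by (rule imageE)
    then have "fst z \<in> K" "snd z \<in> K" "w = fst z *s w1 + snd z *s w2"
      by (auto simp: case_prod_beta)
    then show ?thesis
      by blast
  qed
  then show ?thesis
    using that[OF w1(1) w2(1) indep] by blast
qed


section \<open>The Baer subgeometry and its elliptic quadric\<close>

lemma Q_minus_p: "Q (- p) = 0"
  using Q_scale[of "-1" p] Q_p by (simp add: vector_sneg_minus1[symmetric])

text \<open>With \<open>- p\<close> in place of \<open>p\<close> one has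
  \<open>b r (- p) = 1\<close>, which produces the term \<open>x * y\<close> of the canonical
  forms.\<close>

lemma Q_frame:
  assumes "u \<in> U"
  shows "Q (u + x *s r + y *s (- p)) = Q u + x * y"
proof -
  have "Q (u + x *s r + z *s p) = Q u - x * z" for z
    using U_values[OF assms] b_r'[OF assms] by (simp add: form_simps frame_simps)
  from this[of "- y"] show ?thesis
    by (simp add: vector_smult_lneg vector_smult_rneg)
qed

lemma h_frame:
  assumes "u \<in> U"
  shows "h (u + x *s r + y *s (- p)) (u + x *s r + y *s (- p)) = h u u - (x * y ^ q + x ^ q * y)"
proof -
  have "h (u + x *s r + z *s p) (u + x *s r + z *s p) = h u u + (x * z ^ q + x ^ q * z)" for z
    using U_values[OF assms] by (simp add: form_simps frame_simps)
  from this[of "- y"] show ?thesis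
    by (simp add: vector_smult_lneg vector_smult_rneg conj_minus)
qed

lemma W_anisotropic:
  assumes "w \<in> W" "Q w = 0"
  shows "w = 0"
  using U_anisotropic[OF W_in_U[OF assms(1)] assms(2)] h_W[OF assms(1)] assms(2) by simp

text \<open>The matrix with columns \<open>w1\<close>, \<open>w2\<close>, \<open>r\<close>,
  \<open>- p\<close> carries the canonical subgeometry to the required one. On it the Hermitian
  equation follows from the quadric equation, and anisotropy of \<open>Q\<close> on \<open>W\<close>
  makes the binary part irreducible.\<close>

lemma ex_elliptic_subgeometry:
  "\<exists>\<Sigma>. baer_subgeometry q \<Sigma> \<and> common \<subseteq> \<Sigma> \<and> elliptic_quadric_of q \<Sigma> common"
proof -
  obtain w1 w2 where w: "w1 \<in> W" "w2 \<in> W"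
    and indep: "\<And>x y. x *s w1 + y *s w2 = 0 \<Longrightarrow> x = 0 \<and> y = 0"
    and W: "\<And>w. w \<in> W \<Longrightarrow> \<exists>x\<in>K. \<exists>y\<in>K. w = x *s w1 + y *s w2"
    using W_frame by blast
  define M where "M = frame_matrix w1 w2 r (- p)"
  define C where "C = elliptic_matrix (Q w1) (b w1 w2) (Q w2)"
  let ?G = "canonical_subgeometry q :: ('a ^ 4) set set" and ?g = "(`) ((*v) M)"
  have M: "M *v x = (x $ 1 *s w1 + x $ 2 *s w2) + x $ 3 *s r + x $ 4 *s (- p)" for x
    by (simp add: M_def frame_matrix_mult)
  have inU: "x *s w1 + y *s w2 \<in> U" for x y
    using w by (simp add: W_in_U U_add U_scale)
  have inv: "invertible M"
  proof (rule invertible_if_kernel_trivial)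
    fix x assume "M *v x = 0"
    then have eq: "(x $ 1 *s w1 + x $ 2 *s w2) + x $ 3 *s r + x $ 4 *s (- p) = 0"
      by (simp add: M)
    have "h 0 z = 0" for z
      using h_scale_left[of 0 0 z] by simp
    then have "h ((x $ 1 *s w1 + x $ 2 *s w2) + x $ 3 *s r + x $ 4 *s (- p)) z = 0" for z
      using eq by metis
    from this[of p] this[of r] have 34: "x $ 3 = 0" "x $ 4 = 0"
      using U_values[OF W_in_U[OF w(1)]] U_values[OF W_in_U[OF w(2)]]
      by (simp_all add: form_simps frame_simps)
    then have "x $ 1 = 0 \<and> x $ 2 = 0"
      using eq indep by simp
    then show "x = 0"
      using 34 by (simp add: vec_eq_iff forall_4)
  qed
  have QM: "Q (M *v x) = quad_form C x" for x
    unfolding M Q_frame[OF inU] C_def quad_form_elliptic_matrix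
    by (simp add: form_simps algebra_simps)
  \<comment> \<open>For coordinates in \<open>K\<close> the two conjugate terms of
    \<open>h_frame\<close> coincide, and \<open>h_W\<close> handles the part in
    \<open>W\<close>.\<close>
  have hM: "h (M *v x) (M *v x) = - 2 * quad_form C x" if "\<And>i. x $ i \<in> K" for x
  proof -
    have "x $ 1 *s w1 + x $ 2 *s w2 \<in> W"
      using that w by (simp add: W_add W_scale)
    then have "h (M *v x) (M *v x) =
        - 2 * Q (x $ 1 *s w1 + x $ 2 *s w2) - (x $ 3 * x $ 4 + x $ 3 * x $ 4)"
      unfolding M h_frame[OF inU] using that by (simp add: h_W K_iff)
    also have "\<dots> = - 2 * (Q (x $ 1 *s w1 + x $ 2 *s w2) + x $ 3 * x $ 4)"
      by (simp add: algebra_simps)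
    also have "\<dots> = - 2 * quad_form C x"
      unfolding QM[symmetric] M Q_frame[OF inU] ..
    finally show ?thesis .
  qed
  have Mnz: "M *v x \<noteq> 0" if "x \<noteq> 0" for x
    using that inv by (metis invertible_left_inverse matrix_left_invertible_ker)
  have common: "common = ?g ` (?G \<inter> quadric C)"
  proof (intro equalityI subsetI)
    fix X assume "X \<in> ?g ` (?G \<inter> quadric C)"
    then obtain v where v: "v \<noteq> 0" "\<And>i. v $ i \<in> K" "vec.span {v} \<in> quadric C"
      "X = vec.span {M *v v}"
      by (auto simp: canonical_subgeometry_def matrix_image_span_singleton)
    then have "quad_form C v = 0"
      using span_singleton_in_quadric_iff by blast
    then show "X \<in> common"
      using v Mnz QM hM[OF v(2)] by auto
  next
    fix X assume "X \<in> common"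
    then consider "X = vec.span {p}" | w where "w \<in> W" "X = vec.span {lift w}"
      unfolding common_eq by blast
    then obtain v where v: "v \<noteq> 0" "\<And>i. v $ i \<in> K" "X = vec.span {M *v v}" "Q (M *v v) = 0"
    proof cases
      case 1
      define v :: "'a ^ 4" where "v = (\<chi> i. if i = 4 then 1 else 0)"
      have "v $ 4 = 1"
        by (simp add: v_def)
      then have "v \<noteq> 0"
        by auto
      moreover have "v $ i \<in> K" for i
        using K_closed by (simp add: v_def)
      moreover have "M *v v = - p"
        by (simp add: M v_def)
      moreover have "vec.span {- p} = vec.span {p}"
        using span_singleton_scale[of "-1" p] by (simp add: vector_sneg_minus1[symmetric])
      ultimately show ?thesis
        using that 1 Q_minus_p by simp
    next
      case 2
      obtain x y where xy: "x \<in> K" "y \<in> K" "w = x *s w1 + y *s w2"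
        using W 2(1) by blast
      \<comment> \<open>The last coordinate is \<open>- Q w\<close> because \<open>lift w\<close>
        has coefficient \<open>Q w\<close> at \<open>p\<close> and the basis vector is
        \<open>- p\<close>.\<close>
      define v :: "'a ^ 4" where
        "v = (\<chi> i. if i = 1 then x else if i = 2 then y else if i = 3 then 1 else - Q w)"
      have "v $ 3 = 1"
        by (simp add: v_def)
      then have "v \<noteq> 0"
        by auto
      moreover have "v $ i \<in> K" for i
        using xy K_closed Q_W_in_K[OF 2(1)] by (simp add: v_def)
      moreover have "M *v v = lift w"
        using xy(3) b_r[OF W_in_U[OF 2(1)]]
        by (simp add: M v_def lift_def vector_smult_lneg vector_smult_rneg)
      ultimately show ?thesis
        using that 2 lift_common(1)[OF W_in_U[OF 2(1)]] by simp
    qed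
    then have "vec.span {v} \<in> ?G \<inter> quadric C"
      using span_singleton_in_quadric_iff[OF v(1)] QM
      by (auto simp: canonical_subgeometry_def)
    then show "X \<in> ?g ` (?G \<inter> quadric C)"
      using v(3) matrix_image_span_singleton by blast
  qed
  have aniso: "x = 0 \<and> y = 0" if "x \<in> K" "y \<in> K"
    and "x\<^sup>2 * Q w1 + x * y * b w1 w2 + y\<^sup>2 * Q w2 = 0" for x y
  proof -
    have "Q (x *s w1 + y *s w2) = 0"
      using that(3) by (simp add: form_simps algebra_simps)
    moreover have "x *s w1 + y *s w2 \<in> W"
      using that w by (simp add: W_add W_scale)
    ultimately show ?thesis
      using W_anisotropic indep by blast
  qed
  have irr: "irreducible_binary K (Q w1) (b w1 w2) (Q w2)"
    unfolding irreducible_binary_def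
  proof safe
    fix l1 l2 m1 m2 assume l: "l1 \<in> K" "l2 \<in> K"
      and eq: "Q w1 = l1 * m1" "b w1 w2 = l1 * m2 + l2 * m1" "Q w2 = l2 * m2"
    \<comment> \<open>The linear factor \<open>l1 X + l2 Y\<close> vanishes at
      \<open>(l2, - l1)\<close>, so anisotropy kills both coefficients.\<close>
    have "l2 = 0 \<and> - l1 = 0"
      by (rule aniso) (use l K_closed in \<open>auto simp: eq power2_eq_square algebra_simps\<close>)
    then have "1\<^sup>2 * Q w1 + 1 * 0 * b w1 w2 + 0\<^sup>2 * Q w2 = 0"
      using eq by simp
    then show False
      using aniso[OF K_closed(2,1)] by simp
  qed
  have "elliptic_over K C"
  proof -
    have "C $ i $ j \<in> K" for i j
      using K_closed Q_W_in_K b_W_in_K w by (simp add: C_def elliptic_matrix_def)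
    moreover have "invertible (mat 1 :: 'a ^ 4 ^ 4)"
      by (rule invertible_if_kernel_trivial) simp
    moreover have "\<forall>i j. (mat 1 :: 'a ^ 4 ^ 4) $ i $ j \<in> K"
      using K_closed(1,2) by (simp add: mat_def)
    ultimately show ?thesis
      unfolding elliptic_over_def
      using irr Q_W_in_K b_W_in_K w
      by (intro conjI exI[of _ "mat 1"] bexI[of _ "Q w1"] bexI[of _ "b w1 w2"] bexI[of _ "Q w2"])
        (auto simp: C_def quad_form_elliptic_matrix)
  qed
  then have "elliptic_quadric_of q (?g ` ?G) common"
    unfolding elliptic_quadric_of_def
    using common collineation_matrix_image[OF inv] by blast
  moreover have "baer_subgeometry q (?g ` ?G)"
    unfolding baer_subgeometry_def using collineation_matrix_image[OF inv] by blast
  moreover have "common \<subseteq> ?g ` ?G"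
    unfolding common by blast
  ultimately show ?thesis
    by blast
qed

section \<open>Hyperbolicity of the quadric over GF(q^2)\<close>

text \<open>The discriminant of \<open>Q\<close> on \<open>W\<close> lies in \<open>K\<close> and
  has a square root \<open>s\<close> in GF(q^2); the quadratic formula then gives two isotropic
  vectors, one for each sign of \<open>s\<close>.\<close>

lemma ex_isotropic_pair: "\<exists>m1\<in>U. \<exists>m2\<in>U. Q m1 = 0 \<and> Q m2 = 0 \<and> b m1 m2 \<noteq> 0"
proof -
  obtain w1 w2 where w: "w1 \<in> W" "w2 \<in> W"
    and indep: "\<And>x y. x *s w1 + y *s w2 = 0 \<Longrightarrow> x = 0 \<and> y = 0"
    using W_frame by metis
  define a where "a = Q w1"
  define c where "c = b w1 w2"
  define d where "d = Q w2"
  have K: "a \<in> K" "c \<in> K" "d \<in> K"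
    using w by (auto simp: a_def c_def d_def Q_W_in_K b_W_in_K)
  have Qw: "Q (x *s w1 + y *s w2) = x\<^sup>2 * a + y\<^sup>2 * d + x * y * c" for x y
    by (simp add: form_simps a_def c_def d_def algebra_simps)
  have bw: "b (x *s w1 + y *s w2) (x' *s w1 + y' *s w2) =
      2 * x * x' * a + (x * y' + x' * y) * c + 2 * y * y' * d" for x y x' y'
    using b_self[of w1] b_self[of w2] b_sym[of w2 w1]
    by (simp add: form_simps a_def c_def d_def algebra_simps)
  have aniso: "x = 0 \<and> y = 0" if "x \<in> K" "y \<in> K" "Q (x *s w1 + y *s w2) = 0" for x y
    by (rule indep, rule W_anisotropic) (use that w in \<open>simp_all add: W_add W_scale\<close>)
  have "a \<noteq> 0"
  proof
    assume "a = 0"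
    then have "Q (1 *s w1 + 0 *s w2) = 0"
      unfolding Qw by simp
    then show False
      using aniso[OF K_closed(2,1)] by simp
  qed
  have "c\<^sup>2 - 4 * a * d \<in> K"
    using K K_closed by simp
  then obtain s where s: "s\<^sup>2 = c\<^sup>2 - 4 * a * d"
    using K_square by blast
  have "s \<noteq> 0"
  proof
    assume "s = 0"
    \<comment> \<open>For \<open>s = 0\<close> the double root has coordinates in \<open>K\<close>,
      against anisotropy on \<open>W\<close>.\<close>
    have "Q ((- c) *s w1 + (2 * a) *s w2) = - a * (c\<^sup>2 - 4 * a * d)"
      unfolding Qw by (simp add: power2_eq_square algebra_simps)
    then have "Q ((- c) *s w1 + (2 * a) *s w2) = 0"
      using s \<open>s = 0\<close> by simp
    then have "2 * a = 0"
      using aniso[of "- c" "2 * a"] K K_closed by simp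
    then show False
      using two_neq_zero \<open>a \<noteq> 0\<close> by simp
  qed
  let ?m = "\<lambda>s. (s - c) *s w1 + (2 * a) *s w2"
  have zero: "Q (?m t) = 0" if "t\<^sup>2 = c\<^sup>2 - 4 * a * d" for t
  proof -
    have "Q (?m t) = a * (t\<^sup>2 - (c\<^sup>2 - 4 * a * d))"
      unfolding Qw by (simp add: power2_eq_square algebra_simps)
    then show ?thesis
      using that by simp
  qed
  have "b (?m s) (?m (- s)) = - 2 * a * (s\<^sup>2 + (c\<^sup>2 - 4 * a * d))"
    unfolding bw by (simp add: power2_eq_square algebra_simps)
  also have "\<dots> = - 2 * 2 * a * s\<^sup>2"
    unfolding s[symmetric] by simp
  finally have "b (?m s) (?m (- s)) = - 2 * 2 * a * s\<^sup>2" .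
  then have "b (?m s) (?m (- s)) \<noteq> 0"
    using no_zero_divisors[OF two_neq_zero two_neq_zero] \<open>a \<noteq> 0\<close> \<open>s \<noteq> 0\<close> by simp
  moreover have "?m t \<in> U" for t
    by (intro U_add U_scale W_in_U w)
  moreover have "Q (?m (- s)) = 0"
    by (rule zero) (simp add: s)
  ultimately show ?thesis
    using zero[OF s] by blast
qed

text \<open>Two hyperbolic pairs, one in \<open>U\<close> and one from \<open>r\<close> and
  \<open>- p\<close>, form the basis; rescaling one vector of each absorbs \<kappa>.\<close>

lemma hyperbolic_of_scaled:
  assumes "\<kappa> \<noteq> 0" and B: "\<And>x. quad_form B x = \<kappa> * Q x"
  shows "hyperbolic_quadric B"
proof -
  obtain m1 m2 where m: "m1 \<in> U" "m2 \<in> U" "Q m1 = 0" "Q m2 = 0" "b m1 m2 \<noteq> 0"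
    using ex_isotropic_pair by blast
  define e where "e = 1 / (\<kappa> * b m1 m2)"
  define M where "M = frame_matrix m1 (e *s m2) r ((1 / \<kappa>) *s (- p))"
  have form: "quad_form B (M *v x) = x $ 1 * x $ 2 + x $ 3 * x $ 4" for x
  proof -
    have "M *v x = (x $ 1 *s m1 + (x $ 2 * e) *s m2) + x $ 3 *s r + (x $ 4 / \<kappa>) *s (- p)"
      by (simp add: M_def frame_matrix_mult vector_smult_assoc)
    moreover have "x $ 1 *s m1 + (x $ 2 * e) *s m2 \<in> U"
      using m by (simp add: U_add U_scale)
    ultimately have "quad_form B (M *v x) =
        \<kappa> * (Q (x $ 1 *s m1 + (x $ 2 * e) *s m2) + x $ 3 * (x $ 4 / \<kappa>))"
      by (simp only: B Q_frame)
    also have "\<dots> = x $ 1 * x $ 2 * (\<kappa> * b m1 m2 * e) + x $ 3 * x $ 4"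
      using m assms(1) by (simp add: form_simps algebra_simps)
    also have "\<kappa> * b m1 m2 * e = 1"
      using m assms(1) by (simp add: e_def)
    finally show ?thesis
      by simp
  qed
  have "invertible M"
  proof (rule invertible_if_kernel_trivial)
    fix x assume x: "M *v x = 0"
    \<comment> \<open>Adding a kernel vector leaves the canonical form unchanged; testing on zero
      and the unit vectors forces all coordinates of \<open>x\<close> to vanish.\<close>
    have eq: "(x + y) $ 1 * (x + y) $ 2 + (x + y) $ 3 * (x + y) $ 4 =
        y $ 1 * y $ 2 + y $ 3 * y $ 4" for y
      using x form[of "x + y"] form[of y] by (simp add: matrix_vector_right_distrib)
    define e where "e k = (\<chi> i. if i = k then 1 else (0 :: 'a))" for k :: 4
    show "x = 0"
      using eq[of 0] eq[of "e 1"] eq[of "e 2"] eq[of "e 3"] eq[of "e 4"]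
      by (auto simp: vec_eq_iff forall_4 e_def algebra_simps)
  qed
  then show ?thesis
    using form unfolding hyperbolic_quadric_def by blast
qed

end

section \<open>Reduction of the theorem to normalised forms\<close>

theorem theorem7:
  fixes q :: nat
    and A B :: "'a::{field,finite} ^ 4 ^ 4"
    and P :: "('a ^ 4) set"
  assumes "primepow q" and "odd q"
    and "CARD('a) = q\<^sup>2"
    and "hermitian_matrix q A" and "invertible A"
    and "irreducible_quadric B"
    and "P \<in> hermitian_variety q A \<inter> quadric B"
    and "nonsingular_point B P"
    and "hermitian_tangent q A P = quadric_tangent B P"
    and "card (hermitian_variety q A \<inter> quadric B) = q\<^sup>2 + 1"
  shows "hyperbolic_quadric B \<and>
    (\<exists>\<Sigma>. baer_subgeometry q \<Sigma> \<and>
       hermitian_variety q A \<inter> quadric B \<subseteq> \<Sigma> \<and>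
       elliptic_quadric_of q \<Sigma> (hermitian_variety q A \<inter> quadric B))"
proof -
  interpret square_order_field q "TYPE('a)"
    using assms(1-3) by unfold_locales
  let ?h = "herm_form q A" and ?Q = "quad_form B" and ?b = "quad_polar B"
  obtain p where p: "p \<in> P" "quad_gradient B p \<noteq> 0"
    using assms(8) by (auto simp: nonsingular_point_def)
  have p0: "p \<noteq> 0"
  proof
    assume "p = 0"
    then have "quad_gradient B p = 0"
      by (simp add: quad_gradient_def vec_eq_iff)
    then show False
      using p(2) by simp
  qed
  have P: "P = vec.span {p}"
  proof -
    obtain p' where "P = vec.span {p'}"
      using assms(7) by (auto simp: quadric_def proj_points_def)
    then show ?thesis
      using p(1) p0 span_singleton_scale[of _ p'] by (force simp: vec.span_singleton)
  qed
  have hpp: "?h p p = 0" and Qp: "?Q p = 0"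
    using assms(7) p0 span_singleton_in_hermitian_variety_iff span_singleton_in_quadric_iff
    unfolding P by blast+
  have tangent: "?h x p = 0 \<longleftrightarrow> ?b p x = 0" for x
  proof (cases "x = 0")
    case True
    then show ?thesis
      using herm_form_scale_left[of q A 0 0 p] quad_polar_scale[of B 0 0 p] quad_polar_sym[of B 0 p]
      by simp
  next
    case False
    then show ?thesis
      using assms(9) span_singleton_in_hermitian_tangent_iff[of x]
        span_singleton_in_quadric_tangent_iff[of x] unfolding P by blast
  qed
  obtain s where s: "?h s p \<noteq> 0"
    using herm_form_nondegenerate[OF assms(5)] p0 by blast
  \<comment> \<open>The ratio of the two functionals that cut out the common tangent plane, read off
    at a vector \<open>s\<close> outside it.\<close>
  define \<kappa> where "\<kappa> = - (?b p s / ?h s p)"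
  have \<kappa>: "\<kappa> \<noteq> 0"
    using s tangent by (simp add: \<kappa>_def)
  have bp: "?b p x = - (\<kappa> * ?h x p)" for x
  proof -
    \<comment> \<open>Subtracting \<open>c *s s\<close> moves \<open>x\<close> into the common
      tangent plane.\<close>
    define c where "c = ?h x p / ?h s p"
    have "?h (x + (- c) *s s) p = 0"
      using s by (simp only: herm_form_add_left herm_form_scale_left) (simp add: c_def)
    then have "?b p (x + (- c) *s s) = 0"
      using tangent by blast
    then have "?b p x = c * ?b p s"
      by (simp only: quad_polar_add_right quad_polar_scale_right) simp
    then show ?thesis
      using s by (simp add: c_def \<kappa>_def field_simps)
  qed
  have common: "hermitian_variety q A \<inter> quadric B =
      {vec.span {v} | v. v \<noteq> 0 \<and> ?h v v = 0 \<and> ?Q v / \<kappa> = 0}"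
  proof -
    have mem: "X \<in> hermitian_variety q A \<inter> quadric B \<longleftrightarrow>
        (\<exists>v. X = vec.span {v} \<and> v \<noteq> 0 \<and> ?h v v = 0 \<and> ?Q v / \<kappa> = 0)" for X
    proof
      assume X: "X \<in> hermitian_variety q A \<inter> quadric B"
      then obtain v where "X = vec.span {v}" "v \<noteq> 0"
        by (auto simp: quadric_def proj_points_def)
      then show "\<exists>v. X = vec.span {v} \<and> v \<noteq> 0 \<and> ?h v v = 0 \<and> ?Q v / \<kappa> = 0"
        using X span_singleton_in_hermitian_variety_iff span_singleton_in_quadric_iff
        by (metis IntE div_0)
    qed (use \<kappa> in \<open>auto simp: span_singleton_in_hermitian_variety_iff
        span_singleton_in_quadric_iff\<close>)
    show ?thesis
      by (rule Set.set_eqI, unfold mem_Collect_eq, rule mem)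
  qed
  \<comment> \<open>Dividing \<open>Q\<close> and its polar form by \<kappa> keeps the common points
    and turns \<open>bp\<close> into the normalisation \<open>b_p\<close>.\<close>
  interpret tangent_pair q "TYPE('a)" ?h "\<lambda>x y. ?b x y / \<kappa>" "\<lambda>x. ?Q x / \<kappa>" p
  proof
    show "?h y x = ?h x y ^ q" for x y
      by (rule herm_form_conj[OF assms(4)])
    show "y = 0" if "\<And>x. ?h x y = 0" for y
      using herm_form_nondegenerate[OF assms(5) that] .
    show "?b y x / \<kappa> = ?b x y / \<kappa>" for x y
      by (simp add: quad_polar_sym)
    show "?b p x / \<kappa> = - ?h x p" for x
      using \<kappa> bp by simp
    show "card {vec.span {v} | v. v \<noteq> 0 \<and> ?h v v = 0 \<and> ?Q v / \<kappa> = 0} = q\<^sup>2 + 1"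
      using assms(10) common by simp
  qed (simp_all add: herm_form_add_left herm_form_scale_left quad_polar_add quad_polar_scale
      quad_form_add quad_form_scale add_divide_distrib p0 hpp Qp)
  obtain r where r: "?h r r = 0" "?Q r / \<kappa> = 0" "?h r p = 1"
    using ex_common_off_tangent_plane by blast
  interpret tangent_pair_frame q "TYPE('a)" ?h "\<lambda>x y. ?b x y / \<kappa>" "\<lambda>x. ?Q x / \<kappa>" p r
    using r by unfold_locales
  show ?thesis
    using hyperbolic_of_scaled[OF \<kappa>, of B] ex_elliptic_subgeometry \<kappa> unfolding common by simp
qed

end
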